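(* Let $F:\mathbb{C}^n\to\mathbb{C}^n$ be a power series mapping with components $F_i(X_1,\dots,X_n):=X_i-\sum_{\alpha\ne0}\frac{H_{i,\alpha}}{\alpha!}X^\alpha$ converging in a neighbourhood of $0$, and suppose $\sum_{k=0}^\infty A^k$ converges, where $A_{i,j}=H_{i,\mathbf{e}_j}$. Then $F$ has an analytic inverse with $F_i^{-1}(X_1,\dots,X_n)=\sum_{\alpha\ne0}g_{i,\alpha}X^\alpha$, where $$g_{i,\alpha}:=\sum_{\mathcal{T}\in\mathbb{S}_{i,\alpha}}\ \prod_{v\text{ internal vertex of }\mathcal{T}}\frac{H_{\tau(v),\mu(v)}}{|\mu(v)|!}.$$
   Context: For $\alpha\in\mathbb{Z}^n_{\ge0}$: $\alpha!=\alpha_1!\cdots\alpha_n!$, $|\alpha|=\alpha_1+\dots+\alpha_n$, $X^\alpha=X_1^{\alpha_1}\cdots X_n^{\alpha_n}$; $\mathbf{e}_j$ is the $j$-th unit multi-index. An $n$-type tree $\mathcal{T}=(T,\tau)$ is a finite rooted planar tree (children ordered left to right, any finite number of children) with types $\tau:V\to[n]$; no constraint is imposed on the order of types among siblings. A vertex is internal if it has a child; for internal $v$, $\mu(v)\in\mathbb{Z}^n_{\ge0}$ counts its children of each type, so $|\mu(v)|$ is its number of children. $\mathbb{S}_{i,\alpha}$ is the set of such $n$-type trees with root type $i$ and exactly $\alpha_j$ leaves of type $j$ for each $j$.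
   Formalization: The infinite sum over trees defining g_{i,α} need not converge unconditionally when only ΣA^k converges (e.g. A=[[1,1],[-1,-1]]), so it is taken as the limit, proved to exist, of the sums over trees with at most N vertices as N→∞. *)

theory Defs
  imports "HOL-Analysis.Analysis"
begin

text \<open>Variables are indexed by a finite type 'n (so n = CARD('n)); multi-indices are
  functions 'n \<Rightarrow> nat; points of C^n are functions 'n \<Rightarrow> complex.\<close>

definition mfact :: "('n::finite \<Rightarrow> nat) \<Rightarrow> nat" where
  "mfact \<alpha> = (\<Prod>j\<in>UNIV. fact (\<alpha> j))"

definition monom :: "('n::finite \<Rightarrow> complex) \<Rightarrow> ('n \<Rightarrow> nat) \<Rightarrow> complex" where
  "monom z \<alpha> = (\<Prod>j\<in>UNIV. z j ^ \<alpha> j)"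

definition unitidx :: "'n \<Rightarrow> ('n \<Rightarrow> nat)" where
  "unitidx j = (\<lambda>k. if k = j then 1 else 0)"

definition ps_conv :: "(('n::finite \<Rightarrow> nat) \<Rightarrow> complex) \<Rightarrow> ('n \<Rightarrow> complex) \<Rightarrow> bool" where
  "ps_conv c z \<longleftrightarrow> (\<lambda>\<alpha>. c \<alpha> * monom z \<alpha>) summable_on UNIV"

definition ps_eval :: "(('n::finite \<Rightarrow> nat) \<Rightarrow> complex) \<Rightarrow> ('n \<Rightarrow> complex) \<Rightarrow> complex" where
  "ps_eval c z = (\<Sum>\<^sub>\<infinity>\<alpha>. c \<alpha> * monom z \<alpha>)"

definition map_conv_on :: "('n::finite \<Rightarrow> ('n \<Rightarrow> nat) \<Rightarrow> complex) \<Rightarrow> real \<Rightarrow> bool" where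
  "map_conv_on C r \<longleftrightarrow> (\<forall>z. (\<forall>j. cmod (z j) < r) \<longrightarrow> (\<forall>i. ps_conv (C i) z))"

definition map_eval :: "('n::finite \<Rightarrow> ('n \<Rightarrow> nat) \<Rightarrow> complex) \<Rightarrow> ('n \<Rightarrow> complex) \<Rightarrow> ('n \<Rightarrow> complex)" where
  "map_eval C z = (\<lambda>i. ps_eval (C i) z)"

definition Fcoeff :: "('n::finite \<Rightarrow> ('n \<Rightarrow> nat) \<Rightarrow> complex) \<Rightarrow> 'n \<Rightarrow> ('n \<Rightarrow> nat) \<Rightarrow> complex" where
  "Fcoeff H i \<alpha> = (if \<alpha> = unitidx i then 1 else 0)
                  - (if \<alpha> = (\<lambda>_. 0) then 0 else H i \<alpha> / of_nat (mfact \<alpha>))"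

definition linmat :: "('n::finite \<Rightarrow> ('n \<Rightarrow> nat) \<Rightarrow> complex) \<Rightarrow> complex^'n^'n" where
  "linmat H = (\<chi> i j. H i (unitidx j))"

primrec mpow :: "'a::comm_ring_1^'n::finite^'n \<Rightarrow> nat \<Rightarrow> 'a^'n^'n" where
  "mpow A 0 = mat 1"
| "mpow A (Suc k) = mpow A k ** A"

text \<open>n-type rooted planar trees: a vertex carries its type and the ordered list of its
  children; a leaf is a vertex with no children.\<close>
datatype 'n ttree = Node 'n "'n ttree list"

fun ttype :: "'n ttree \<Rightarrow> 'n" where
  "ttype (Node t cs) = t"

fun leafcnt :: "'n ttree \<Rightarrow> 'n \<Rightarrow> nat" where
  "leafcnt (Node t cs) j =
     (if cs = [] then (if t = j then 1 else 0) else sum_list (map (\<lambda>c. leafcnt c j) cs))"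

fun nverts :: "'n ttree \<Rightarrow> nat" where
  "nverts (Node t cs) = 1 + sum_list (map nverts cs)"

definition mu :: "'n ttree list \<Rightarrow> 'n \<Rightarrow> nat" where
  "mu cs j = length (filter (\<lambda>c. ttype c = j) cs)"

fun tweight :: "('n \<Rightarrow> ('n \<Rightarrow> nat) \<Rightarrow> complex) \<Rightarrow> 'n ttree \<Rightarrow> complex" where
  "tweight H (Node t cs) =
     (if cs = [] then 1
      else H t (mu cs) / of_nat (fact (length cs)) * prod_list (map (tweight H) cs))"

definition Strees :: "'n \<Rightarrow> ('n \<Rightarrow> nat) \<Rightarrow> 'n ttree set" where
  "Strees i \<alpha> = {T. ttype T = i \<and> leafcnt T = \<alpha>}"

text \<open>Partial sums of g_{i,\<alpha>} over the (finitely many) trees with at most N vertices;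
  the (in general infinite) tree sum g_{i,\<alpha>} is understood as the limit N \<rightarrow> \<infinity>.\<close>
definition gpartial :: "('n::finite \<Rightarrow> ('n \<Rightarrow> nat) \<Rightarrow> complex) \<Rightarrow> 'n \<Rightarrow> ('n \<Rightarrow> nat) \<Rightarrow> nat \<Rightarrow> complex" where
  "gpartial H i \<alpha> N = (\<Sum>T\<in>{T \<in> Strees i \<alpha>. nverts T \<le> N}. tweight H T)"

end

theory Submission
  imports Defs "HOL-Combinatorics.Multiset_Permutations" "HOL-Library.Function_Algebras"
begin

text \<open>
  Let \<open>a \<alpha> m\<close> be the vector whose \<open>i\<close>-th entry is the total weight of the trees with root type \<open>i\<close>,
  leaf counts \<open>\<alpha>\<close> and \<open>m\<close> vertices. Removing the root gives \<open>a \<alpha> (m + 1) = A (a \<alpha> m) + e \<alpha> m\<close>, where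
  \<open>e\<close> collects the single leaf and the trees whose root has at least two children. As \<open>\<Sum>k. |A ^ k|\<close> is
  finite, say \<open>C\<close>, this implies \<open>\<Sum>m. |a \<alpha> m| \<le> C (\<Sum>m. |e \<alpha> m|)\<close>. Since \<open>e\<close> is at least quadratic in
  the \<open>a\<close> with fewer vertices, induction on the number of vertices bounds \<open>\<Sum> |a \<alpha> m| |z ^ \<alpha>|\<close> for
  small \<open>z\<close>. Summing the recursion over all \<open>\<alpha>\<close> and \<open>m\<close>, and counting the \<open>|\<beta>|! / \<beta>!\<close> orderings of
  children of types \<open>\<beta>\<close>, yields \<open>F (G z) = z\<close>. Finally \<open>F\<close> is injective near 0, because
  \<open>x = A x + q\<close> forces \<open>|x| \<le> C |q|\<close> while the nonlinear part of \<open>F\<close> has a small Lipschitz constant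
  there; hence also \<open>G (F w) = w\<close>.
\<close>

section \<open>Unconditional sums\<close>

lemma has_sum_Sigma_fibres_iff:
  "((\<lambda>(y, x). f x) has_sum S) (SIGMA y:UNIV. {x. \<phi> x = y}) \<longleftrightarrow> (f has_sum S) UNIV"
  by (rule has_sum_reindex_bij_witness[where j = snd and i = "\<lambda>x. (\<phi> x, x)"]) auto

lemma has_sum_fibres:
  fixes f :: "'a \<Rightarrow> 'c::{topological_comm_monoid_add,t3_space}"
  assumes "(f has_sum S) UNIV" and "\<And>y. (f has_sum g y) {x. \<phi> x = y}"
  shows "(g has_sum S) UNIV"
  by (rule has_sum_SigmaD[OF has_sum_Sigma_fibres_iff[THEN iffD2, OF assms(1), of \<phi>]]) (simp add: assms(2))

lemma nonneg_has_sum_fibresI: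
  fixes f :: "'a \<Rightarrow> real"
  assumes "\<And>x. 0 \<le> f x" and "\<And>y. (f has_sum g y) {x. \<phi> x = y}" and "(g has_sum S) UNIV"
  shows "(f has_sum S) UNIV"
proof -
  have "(\<lambda>(y, x). f x) summable_on (SIGMA y:UNIV. {x. \<phi> x = y})"
    by (rule summable_on_SigmaI[where g = g]) (use assms in \<open>auto intro: has_sum_imp_summable\<close>)
  then have "((\<lambda>(y, x). f x) has_sum S) (SIGMA y:UNIV. {x. \<phi> x = y})"
    by (intro has_sum_SigmaI[where g = g]) (use assms in auto)
  then show ?thesis by (simp only: has_sum_Sigma_fibres_iff)
qed

lemma sum_norm_fibres_le:
  fixes f :: "'a \<Rightarrow> 'c::banach"
  assumes "(\<lambda>x. norm (f x)) summable_on UNIV" and "finite E"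
    and fibre: "\<And>y. y \<in> E \<Longrightarrow> (f has_sum g y) {x. \<phi> x = y}"
  shows "(\<Sum>y\<in>E. norm (g y)) \<le> (\<Sum>\<^sub>\<infinity>x. norm (f x))"
proof -
  have fibre_norm: "((\<lambda>x. norm (f x)) has_sum (\<Sum>\<^sub>\<infinity>x | \<phi> x = y. norm (f x))) {x. \<phi> x = y}" for y
    using summable_on_subset_banach[OF assms(1)] by (intro has_sum_infsum) auto
  have "(\<Sum>y\<in>E. norm (g y)) \<le> (\<Sum>y\<in>E. \<Sum>\<^sub>\<infinity>x | \<phi> x = y. norm (f x))"
    by (intro sum_mono norm_infsum_le[OF fibre fibre_norm]) auto
  also have "\<dots> \<le> (\<Sum>\<^sub>\<infinity>x. norm (f x))"
    by (rule finite_sum_le_has_sum[OF has_sum_fibres[OF has_sum_infsum[OF assms(1)] fibre_norm]])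
      (use assms(2) in \<open>auto intro: infsum_nonneg\<close>)
  finally show ?thesis .
qed

lemma
  fixes f :: "'a \<times> nat \<Rightarrow> real"
  assumes nonneg: "\<And>p. 0 \<le> f p" and boxes: "\<And>A N. finite A \<Longrightarrow> sum f (A \<times> {..N}) \<le> B"
  shows summable_on_boxesI: "f summable_on UNIV"
    and infsum_boxes_le: "infsum f UNIV \<le> B"
proof -
  have finite_sum_le: "sum f F \<le> B" if "finite F" for F
  proof -
    obtain N where "snd p \<le> N" if "p \<in> F" for p
      using finite_nat_set_iff_bounded_le[of "snd ` F"] \<open>finite F\<close> by auto
    then have "F \<subseteq> fst ` F \<times> {..N}" by force
    then have "sum f F \<le> sum f (fst ` F \<times> {..N})"
      using that nonneg by (intro sum_mono2) auto
    also have "\<dots> \<le> B"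
      using that by (intro boxes) simp
    finally show ?thesis .
  qed
  show "f summable_on UNIV"
    by (rule nonneg_bdd_above_summable_on) (use nonneg finite_sum_le in \<open>auto intro!: bdd_aboveI\<close>)
  then show "infsum f UNIV \<le> B"
    by (rule infsum_le_finite_sums) (use finite_sum_le in auto)
qed

lemma
  fixes f :: "'a \<Rightarrow> 'c::{real_normed_field,banach}"
  assumes "(\<lambda>x. norm (f x)) summable_on A" and "(\<lambda>y. norm (g y)) summable_on B"
  shows abs_summable_on_Times: "(\<lambda>(x, y). norm (f x * g y)) summable_on A \<times> B"
    and has_sum_Times: "((\<lambda>(x, y). f x * g y) has_sum infsum f A * infsum g B) (A \<times> B)"
proof -
  have "(\<lambda>(x, y). norm (f x) * norm (g y)) summable_on A \<times> B"
  proof (rule summable_on_SigmaI[where g = "\<lambda>x. norm (f x) * (\<Sum>\<^sub>\<infinity>y\<in>B. norm (g y))"])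
    show "((\<lambda>y. case (x, y) of (x, y) \<Rightarrow> norm (f x) * norm (g y)) has_sum
        norm (f x) * (\<Sum>\<^sub>\<infinity>y\<in>B. norm (g y))) B" for x
      unfolding prod.case by (intro has_sum_cmult_right has_sum_infsum assms)
  qed (auto intro: summable_on_cmult_left assms(1))
  then show norm_summable: "(\<lambda>(x, y). norm (f x * g y)) summable_on A \<times> B"
    by (simp only: norm_mult)
  show "((\<lambda>(x, y). f x * g y) has_sum infsum f A * infsum g B) (A \<times> B)"
  proof (rule has_sum_SigmaI[where g = "\<lambda>x. f x * infsum g B"])
    show "((\<lambda>y. case (x, y) of (x, y) \<Rightarrow> f x * g y) has_sum f x * infsum g B) B" for x
      unfolding prod.case
      by (intro has_sum_cmult_right has_sum_infsum assms(1,2)[THEN abs_summable_summable])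
    show "((\<lambda>x. f x * infsum g B) has_sum infsum f A * infsum g B) A"
      by (intro has_sum_cmult_left has_sum_infsum assms(1,2)[THEN abs_summable_summable])
    show "(\<lambda>(x, y). f x * g y) summable_on A \<times> B"
      by (rule abs_summable_summable) (use norm_summable in \<open>simp add: case_prod_unfold\<close>)
  qed
qed

lemma has_sum_sum:
  fixes f :: "'i \<Rightarrow> 'a \<Rightarrow> 'b::topological_comm_monoid_add"
  assumes "\<And>i. i \<in> I \<Longrightarrow> (f i has_sum S i) A"
  shows "((\<lambda>x. \<Sum>i\<in>I. f i x) has_sum (\<Sum>i\<in>I. S i)) A"
  using assms by (induction I rule: infinite_finite_induct) (auto intro!: has_sum_add)

lemma has_sum_Suc_snd_iff:
  assumes "\<And>a. f (a, 0) = 0"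
  shows "((\<lambda>p. f (fst p, Suc (snd p))) has_sum S) UNIV \<longleftrightarrow> (f has_sum S) UNIV"
proof -
  have "((\<lambda>p. f (fst p, Suc (snd p))) has_sum S) UNIV \<longleftrightarrow> (f has_sum S) {p. snd p \<noteq> 0}"
    by (rule has_sum_reindex_bij_witness[where j = "\<lambda>p. (fst p, Suc (snd p))"
          and i = "\<lambda>p. (fst p, snd p - 1)"]) auto
  also have "\<dots> \<longleftrightarrow> (f has_sum S) UNIV"
    by (rule has_sum_cong_neutral) (auto simp: assms)
  finally show ?thesis .
qed

section \<open>Power series on polydiscs\<close>

definition mdeg :: "('n::finite \<Rightarrow> nat) \<Rightarrow> nat" where
  "mdeg \<beta> = (\<Sum>j\<in>UNIV. \<beta> j)"

lemma mdeg_eq_0_iff: "mdeg \<beta> = 0 \<longleftrightarrow> \<beta> = 0"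
  by (auto simp: mdeg_def fun_eq_iff)

lemma mdeg_unitidx [simp]: "mdeg (unitidx j) = 1"
  by (simp add: mdeg_def unitidx_def)

lemma mdeg_eq_1D:
  assumes "mdeg \<beta> = 1"
  shows "\<beta> \<in> range unitidx"
proof -
  obtain j where "\<beta> j = 1" and "\<forall>k. k \<noteq> j \<longrightarrow> \<beta> k = 0"
    using assms unfolding mdeg_def sum_eq_1_iff[OF finite] by auto
  then have "\<beta> = unitidx j" by (auto simp: unitidx_def)
  then show ?thesis by simp
qed

lemma inj_unitidx: "inj unitidx"
  by (auto simp: inj_on_def unitidx_def fun_eq_iff split: if_splits)

lemma mfact_unitidx [simp]: "mfact (unitidx j) = 1"
  unfolding mfact_def unitidx_def by (rule prod.neutral) auto

lemma monom_0 [simp]: "monom z 0 = 1"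
  by (simp add: monom_def)

lemma monom_add: "monom z (\<alpha> + \<beta>) = monom z \<alpha> * monom z \<beta>"
  by (simp add: monom_def power_add prod.distrib)

lemma monom_unitidx [simp]: "monom z (unitidx j) = z j"
proof -
  have "monom z (unitidx j) = (\<Prod>k\<in>UNIV. if k = j then z k else 1)"
    unfolding monom_def unitidx_def by (rule prod.cong) auto
  then show ?thesis by simp
qed

lemma monom_scale: "monom (\<lambda>j. a * z j) \<beta> = a ^ mdeg \<beta> * monom z \<beta>"
  by (simp add: monom_def mdeg_def power_mult_distrib prod.distrib power_sum)

lemma norm_monom_le:
  assumes "\<And>j. cmod (z j) \<le> x"
  shows "cmod (monom z \<beta>) \<le> x ^ mdeg \<beta>"
  unfolding monom_def mdeg_def prod_norm[symmetric] norm_power power_sum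
  by (intro prod_mono) (auto intro: power_mono assms)

lemma norm_monom_diff_le:
  assumes "0 < \<rho>" and v_le: "\<And>j. cmod (v j) \<le> \<rho>" and w_le: "\<And>j. cmod (w j) \<le> \<rho>"
    and diff_le: "\<And>j. cmod (v j - w j) \<le> \<delta>"
  shows "cmod (monom v \<beta> - monom w \<beta>) \<le> real (mdeg \<beta>) * \<rho> ^ mdeg \<beta> * (\<delta> / \<rho>)"
proof -
  define v' w' where "v' j = v j / \<rho>" and "w' j = w j / \<rho>" for j
  have scaled_le_1: "cmod (v' j) \<le> 1" "cmod (w' j) \<le> 1" for j
    using assms(1) v_le[of j] w_le[of j] by (simp_all add: v'_def w'_def norm_divide)
  have scaled_diff_le: "cmod (v' j - w' j) \<le> \<delta> / \<rho>" for j
    using assms(1) divide_right_mono[OF diff_le, of \<rho> j]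
    by (simp add: v'_def w'_def norm_divide flip: diff_divide_distrib)
  have "cmod (monom v' \<beta> - monom w' \<beta>) \<le> (\<Sum>j\<in>UNIV. cmod (v' j ^ \<beta> j - w' j ^ \<beta> j))"
    unfolding monom_def using scaled_le_1 by (intro norm_prod_diff) (simp_all add: norm_power power_le_one)
  also have "\<dots> \<le> (\<Sum>j\<in>UNIV. real (\<beta> j) * (\<delta> / \<rho>))"
    by (intro sum_mono order_trans[OF norm_power_diff] mult_left_mono scaled_le_1 scaled_diff_le) auto
  also have "\<dots> = real (mdeg \<beta>) * (\<delta> / \<rho>)"
    unfolding mdeg_def of_nat_sum sum_distrib_right ..
  finally have "\<rho> ^ mdeg \<beta> * cmod (monom v' \<beta> - monom w' \<beta>) \<le> \<rho> ^ mdeg \<beta> * (real (mdeg \<beta>) * (\<delta> / \<rho>))"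
    using assms(1) by (intro mult_left_mono) auto
  moreover have "monom v \<beta> - monom w \<beta> = of_real \<rho> ^ mdeg \<beta> * (monom v' \<beta> - monom w' \<beta>)"
    using assms(1) by (simp add: v'_def w'_def right_diff_distrib flip: monom_scale)
  ultimately show ?thesis
    using assms(1) by (simp add: norm_mult norm_power mult_ac)
qed

definition abs_conv :: "(('n::finite \<Rightarrow> nat) \<Rightarrow> complex) \<Rightarrow> real \<Rightarrow> bool" where
  "abs_conv c x \<longleftrightarrow> (\<lambda>\<beta>. cmod (c \<beta>) * x ^ mdeg \<beta>) summable_on UNIV"

definition ps_majorant :: "(('n::finite \<Rightarrow> nat) \<Rightarrow> complex) \<Rightarrow> real \<Rightarrow> real" where
  "ps_majorant c x = (\<Sum>\<^sub>\<infinity>\<beta>. cmod (c \<beta>) * x ^ mdeg \<beta>)"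

lemma abs_conv_has_sum: "abs_conv c x \<Longrightarrow> ((\<lambda>\<beta>. cmod (c \<beta>) * x ^ mdeg \<beta>) has_sum ps_majorant c x) UNIV"
  unfolding abs_conv_def ps_majorant_def by (rule has_sum_infsum)

lemma map_conv_on_imp_abs_conv:
  assumes "map_conv_on C r" and "0 \<le> x" and "x < r"
  shows "abs_conv (C i) x"
proof -
  have "monom (\<lambda>_. of_real x) \<beta> = of_real (x ^ mdeg \<beta>)" for \<beta> :: "'a \<Rightarrow> nat"
    by (simp add: monom_def mdeg_def power_sum)
  moreover have "ps_conv (C i) (\<lambda>_. of_real x)"
    using assms by (simp add: map_conv_on_def)
  ultimately show ?thesis
    using assms(2) unfolding ps_conv_def abs_conv_def summable_on_iff_abs_summable_on_complex
    by (simp add: norm_mult norm_power del: of_real_power)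
qed

lemma
  assumes "abs_conv c x" and "\<And>j. cmod (v j) \<le> x"
  shows abs_conv_imp_has_sum: "((\<lambda>\<beta>. c \<beta> * monom v \<beta>) has_sum ps_eval c v) UNIV"
    and norm_ps_eval_le: "cmod (ps_eval c v) \<le> ps_majorant c x"
proof -
  have term_le: "cmod (c \<beta> * monom v \<beta>) \<le> cmod (c \<beta>) * x ^ mdeg \<beta>" for \<beta>
    unfolding norm_mult by (intro mult_left_mono norm_monom_le assms) simp
  have "(\<lambda>\<beta>. cmod (c \<beta> * monom v \<beta>)) summable_on UNIV"
    by (rule summable_on_comparison_test[OF assms(1)[unfolded abs_conv_def] term_le]) simp
  then show has_sum: "((\<lambda>\<beta>. c \<beta> * monom v \<beta>) has_sum ps_eval c v) UNIV"
    unfolding ps_eval_def by (intro has_sum_infsum) (rule abs_summable_summable)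
  show "cmod (ps_eval c v) \<le> ps_majorant c x"
    by (rule norm_infsum_le[OF has_sum abs_conv_has_sum[OF assms(1)] term_le])
qed

lemma
  assumes conv: "abs_conv c x" and order: "\<And>\<beta>. mdeg \<beta> < d \<Longrightarrow> c \<beta> = 0" and "0 \<le> s" "s \<le> x" "0 < x"
  shows abs_conv_smaller_radius: "abs_conv c s"
    and ps_majorant_smaller_radius: "ps_majorant c s \<le> (s / x) ^ d * ps_majorant c x"
proof -
  have term_le: "cmod (c \<beta>) * s ^ mdeg \<beta> \<le> (s / x) ^ d * (cmod (c \<beta>) * x ^ mdeg \<beta>)" for \<beta>
  proof (cases "mdeg \<beta> < d")
    case False
    then have "(s / x) ^ mdeg \<beta> \<le> (s / x) ^ d"
      using assms(3-5) by (intro power_decreasing) auto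
    then have "(s / x) ^ mdeg \<beta> * (cmod (c \<beta>) * x ^ mdeg \<beta>) \<le> (s / x) ^ d * (cmod (c \<beta>) * x ^ mdeg \<beta>)"
      using assms(5) by (intro mult_right_mono) auto
    then show ?thesis using assms(5) by (simp add: power_divide mult.commute)
  qed (simp add: order)
  have scaled: "((\<lambda>\<beta>. (s / x) ^ d * (cmod (c \<beta>) * x ^ mdeg \<beta>)) has_sum (s / x) ^ d * ps_majorant c x) UNIV"
    by (intro has_sum_cmult_right abs_conv_has_sum conv)
  show smaller: "abs_conv c s"
    unfolding abs_conv_def
    by (rule summable_on_comparison_test[OF has_sum_imp_summable[OF scaled] term_le]) (use assms(3) in simp)
  show "ps_majorant c s \<le> (s / x) ^ d * ps_majorant c x"
    by (rule has_sum_mono[OF abs_conv_has_sum[OF smaller] scaled term_le])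
qed

lemma of_nat_times_power_le_square:
  fixes t :: real
  assumes "0 \<le> t" "t \<le> 1 / 2" "2 \<le> n"
  shows "real n * t ^ n \<le> 4 * t\<^sup>2"
proof -
  obtain m where n_eq: "n = m + 2" using assms(3) by (metis add.commute le_Suc_ex)
  have "real n \<le> 2 ^ n"
    using less_exp[of n] by (metis less_imp_le of_nat_le_iff of_nat_numeral of_nat_power)
  then have "real n * t ^ m \<le> 2 ^ n * (1 / 2) ^ m"
    using assms by (intro mult_mono power_mono) auto
  also have "\<dots> = 4" by (simp add: n_eq power_divide)
  finally have "real n * t ^ m * t\<^sup>2 \<le> 4 * t\<^sup>2" by (intro mult_right_mono) auto
  then show ?thesis by (simp only: n_eq power_add mult.assoc)
qed

lemma norm_ps_eval_diff_le:
  assumes conv: "abs_conv c x" and order: "\<And>\<beta>. mdeg \<beta> < 2 \<Longrightarrow> c \<beta> = 0" and radii: "0 < \<rho>" "2 * \<rho> \<le> x"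
    and v_le: "\<And>j. cmod (v j) \<le> \<rho>" and w_le: "\<And>j. cmod (w j) \<le> \<rho>" and diff_le: "\<And>j. cmod (v j - w j) \<le> \<delta>"
  shows "cmod (ps_eval c v - ps_eval c w) \<le> 4 * \<rho> / x\<^sup>2 * ps_majorant c x * \<delta>"
proof -
  have x_pos: "0 < x" and radius_le: "\<rho> \<le> x" using radii by auto
  have "0 \<le> \<delta>" using diff_le norm_ge_zero order_trans by blast
  have term_le: "cmod (c \<beta> * monom v \<beta> - c \<beta> * monom w \<beta>)
      \<le> 4 * \<rho> / x\<^sup>2 * \<delta> * (cmod (c \<beta>) * x ^ mdeg \<beta>)" for \<beta>
  proof (cases "mdeg \<beta> < 2")
    case False
    have "cmod (monom v \<beta> - monom w \<beta>) \<le> real (mdeg \<beta>) * \<rho> ^ mdeg \<beta> * (\<delta> / \<rho>)"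
      by (rule norm_monom_diff_le[OF radii(1) v_le w_le diff_le])
    also have "\<dots> = (real (mdeg \<beta>) * (\<rho> / x) ^ mdeg \<beta>) * x ^ mdeg \<beta> * (\<delta> / \<rho>)"
      using x_pos by (simp add: power_divide)
    also have "\<dots> \<le> (4 * (\<rho> / x)\<^sup>2) * x ^ mdeg \<beta> * (\<delta> / \<rho>)"
      using radii x_pos False \<open>0 \<le> \<delta>\<close>
      by (intro mult_right_mono of_nat_times_power_le_square) (auto simp: divide_le_eq)
    also have "\<dots> = 4 * \<rho> / x\<^sup>2 * \<delta> * x ^ mdeg \<beta>"
      using radii by (simp add: power2_eq_square)
    finally have "cmod (c \<beta>) * cmod (monom v \<beta> - monom w \<beta>) \<le> cmod (c \<beta>) * (4 * \<rho> / x\<^sup>2 * \<delta> * x ^ mdeg \<beta>)"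
      by (rule mult_left_mono) simp
    then show ?thesis by (simp add: mult_ac flip: norm_mult right_diff_distrib)
  qed (simp add: order)
  have "((\<lambda>\<beta>. c \<beta> * monom v \<beta> - c \<beta> * monom w \<beta>) has_sum ps_eval c v - ps_eval c w) UNIV"
    unfolding diff_conv_add_uminus using v_le w_le radius_le order_trans
    by (intro has_sum_add has_sum_uminusI abs_conv_imp_has_sum[OF conv]) blast+
  from norm_infsum_le[OF this has_sum_cmult_right[OF abs_conv_has_sum[OF conv]] term_le]
  show ?thesis by (simp add: mult_ac)
qed

definition local_right_inverse ::
  "('n::finite \<Rightarrow> ('n \<Rightarrow> nat) \<Rightarrow> complex) \<Rightarrow> ('n \<Rightarrow> ('n \<Rightarrow> nat) \<Rightarrow> complex) \<Rightarrow> bool" where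
  "local_right_inverse F G \<longleftrightarrow> (\<exists>r>0. map_conv_on G r \<and>
     (\<forall>z. (\<forall>j. cmod (z j) < r) \<longrightarrow> (\<forall>i. ps_conv (F i) (map_eval G z)) \<and> map_eval F (map_eval G z) = z))"

section \<open>Substituting sums into an exponential power series\<close>

lemma prod_list_eq_prod_count:
  fixes y :: "'n::finite \<Rightarrow> 'a::comm_monoid_mult"
  shows "prod_list (map y ts) = (\<Prod>j\<in>UNIV. y j ^ count_list ts j)"
proof (induction ts)
  case (Cons t ts)
  have "(\<Prod>j\<in>UNIV. y j ^ count_list (t # ts) j)
      = (\<Prod>j\<in>UNIV. (if j = t then y j else 1) * y j ^ count_list ts j)"
    by (rule prod.cong) auto
  then show ?case using Cons by (simp add: prod.distrib)
qed simp

lemma mdeg_count_list: "mdeg (count_list (ts :: 'n::finite list)) = length ts"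
  by (simp add: mdeg_def sum_count_set[of ts UNIV])

lemma lists_with_count_eq_permutations:
  "{ts. count_list ts = \<beta>} = permutations_of_multiset (Abs_multiset (\<beta> :: 'n::finite \<Rightarrow> nat))"
  by (auto simp: permutations_of_multiset_def multiset_eq_iff count_mset)

lemma finite_lists_with_count: "finite {ts. count_list ts = (\<beta> :: 'n::finite \<Rightarrow> nat)}"
  by (simp add: lists_with_count_eq_permutations)

lemma card_lists_with_count:
  fixes \<beta> :: "'n::finite \<Rightarrow> nat"
  shows "card {ts. count_list ts = \<beta>} * mfact \<beta> = fact (mdeg \<beta>)"
proof -
  have "(\<Prod>x\<in>set_mset (Abs_multiset \<beta>). fact (\<beta> x)) = mfact \<beta>"
    unfolding mfact_def by (rule prod.mono_neutral_left) (auto simp: set_mset_def)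
  moreover have "size (Abs_multiset \<beta>) = mdeg \<beta>"
    unfolding size_multiset_overloaded_eq mdeg_def
    by (rule sum.mono_neutral_cong_left) (auto simp: set_mset_def)
  ultimately show ?thesis
    using card_permutations_of_multiset_aux[of "Abs_multiset \<beta>"]
    by (simp add: lists_with_count_eq_permutations)
qed

definition egf_coeff :: "(('n::finite \<Rightarrow> nat) \<Rightarrow> 'a::field) \<Rightarrow> ('n \<Rightarrow> nat) \<Rightarrow> 'a" where
  "egf_coeff c \<beta> = c \<beta> / of_nat (mfact \<beta>)"

lemma has_sum_lists_with_count:
  fixes y :: "'n::finite \<Rightarrow> 'a::{real_normed_field,banach}"
  shows "((\<lambda>ts. c (count_list ts) / fact (length ts) * prod_list (map y ts)) has_sum
          egf_coeff c \<beta> * (\<Prod>j\<in>UNIV. y j ^ \<beta> j)) {ts. count_list ts = \<beta>}"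
proof -
  let ?L = "{ts. count_list ts = \<beta>}"
  have "(\<Sum>ts\<in>?L. c (count_list ts) / fact (length ts) * prod_list (map y ts))
      = (\<Sum>ts\<in>?L. c \<beta> / fact (mdeg \<beta>) * (\<Prod>j\<in>UNIV. y j ^ \<beta> j))"
    by (rule sum.cong) (auto simp: prod_list_eq_prod_count mdeg_count_list)
  also have "\<dots> = of_nat (card ?L) / fact (mdeg \<beta>) * (c \<beta> * (\<Prod>j\<in>UNIV. y j ^ \<beta> j))"
    by simp
  also have "of_nat (card ?L) / fact (mdeg \<beta>) = (1 / of_nat (mfact \<beta>) :: 'a)"
  proof -
    have "(fact (mdeg \<beta>) :: 'a) = of_nat (card ?L) * of_nat (mfact \<beta>)"
      by (metis card_lists_with_count of_nat_fact of_nat_mult)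
    moreover from this have "(of_nat (card ?L) :: 'a) \<noteq> 0" by (metis fact_nonzero mult_zero_left)
    ultimately show ?thesis by simp
  qed
  finally show ?thesis by (simp add: egf_coeff_def has_sum_finite_iff finite_lists_with_count)
qed

lemma lists_with_types_Cons:
  "{ss. map fst ss = t # ts} = (\<lambda>(k, ss). (t, k) # ss) ` (UNIV \<times> {ss. map fst ss = ts})"
  by (auto simp: map_eq_Cons_conv image_iff)

lemma norm_prod_list:
  fixes f :: "'b \<Rightarrow> 'a::real_normed_field"
  shows "norm (prod_list (map f xs)) = prod_list (map (\<lambda>x. norm (f x)) xs)"
  by (induction xs) (auto simp: norm_mult)

lemma
  fixes f :: "'t \<times> 'k \<Rightarrow> 'a::{real_normed_field,banach}"
  assumes "\<And>t. (\<lambda>k. norm (f (t, k))) summable_on UNIV"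
  shows norm_prod_list_summable: "(\<lambda>ss. norm (prod_list (map f ss))) summable_on {ss. map fst ss = ts}"
    and has_sum_prod_list:
      "((\<lambda>ss. prod_list (map f ss)) has_sum prod_list (map (\<lambda>t. \<Sum>\<^sub>\<infinity>k. f (t, k)) ts)) {ss. map fst ss = ts}"
proof (induction ts)
  case Nil
  show "(\<lambda>ss. norm (prod_list (map f ss))) summable_on {ss. map fst ss = []}"
    and "((\<lambda>ss. prod_list (map f ss)) has_sum prod_list (map (\<lambda>t. \<Sum>\<^sub>\<infinity>k. f (t, k)) [])) {ss. map fst ss = []}"
    by (simp_all add: has_sum_finite_iff)
next
  case (Cons t ts)
  have inj_Cons: "inj_on (\<lambda>(k, ss). (t, k) # ss) (UNIV \<times> {ss. map fst ss = ts})"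
    by (auto simp: inj_on_def)
  note product = assms[of t] Cons.IH(1)
  show "(\<lambda>ss. norm (prod_list (map f ss))) summable_on {ss. map fst ss = t # ts}"
    using abs_summable_on_Times[OF product]
    unfolding lists_with_types_Cons summable_on_reindex[OF inj_Cons] by (simp add: o_def case_prod_unfold)
  show "((\<lambda>ss. prod_list (map f ss)) has_sum prod_list (map (\<lambda>t. \<Sum>\<^sub>\<infinity>k. f (t, k)) (t # ts)))
      {ss. map fst ss = t # ts}"
    using has_sum_Times[OF product] infsumI[OF Cons.IH(2)]
    unfolding lists_with_types_Cons has_sum_reindex[OF inj_Cons] by (simp add: o_def case_prod_unfold)
qed

definition list_term :: "(('n \<Rightarrow> nat) \<Rightarrow> 'a::real_normed_field) \<Rightarrow> ('n \<times> 'k \<Rightarrow> 'a) \<Rightarrow> ('n \<times> 'k) list \<Rightarrow> 'a" where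
  "list_term c f ss = c (count_list (map fst ss)) / fact (length ss) * prod_list (map f ss)"

context
  fixes f :: "'n::finite \<times> 'k \<Rightarrow> complex" and c :: "('n \<Rightarrow> nat) \<Rightarrow> complex" and x :: real
  assumes f_summable: "\<And>t. (\<lambda>k. norm (f (t, k))) summable_on UNIV"
    and f_le: "\<And>t. (\<Sum>\<^sub>\<infinity>k. norm (f (t, k))) \<le> x"
    and c_conv: "abs_conv (egf_coeff c) x"
begin

lemma has_sum_norm_list_term_of_type:
  "((\<lambda>ss. norm (list_term c f ss)) has_sum
     norm (c (count_list ts)) / fact (length ts) * prod_list (map (\<lambda>t. \<Sum>\<^sub>\<infinity>k. norm (f (t, k))) ts))
       {ss. map fst ss = ts}"
proof -
  have "((\<lambda>ss. norm (c (count_list ts)) / fact (length ts) * prod_list (map (\<lambda>s. norm (f s)) ss)) has_sum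
     norm (c (count_list ts)) / fact (length ts) * prod_list (map (\<lambda>t. \<Sum>\<^sub>\<infinity>k. norm (f (t, k))) ts))
       {ss. map fst ss = ts}"
    by (intro has_sum_cmult_right has_sum_prod_list) (simp add: f_summable)
  then show ?thesis
    by (rule has_sum_cong[THEN iffD1, rotated])
      (auto simp: list_term_def norm_mult norm_divide norm_prod_list)
qed

lemma has_sum_list_term_of_type:
  "(list_term c f has_sum
     c (count_list ts) / fact (length ts) * prod_list (map (\<lambda>t. \<Sum>\<^sub>\<infinity>k. f (t, k)) ts)) {ss. map fst ss = ts}"
proof -
  have "((\<lambda>ss. c (count_list ts) / fact (length ts) * prod_list (map f ss)) has_sum
     c (count_list ts) / fact (length ts) * prod_list (map (\<lambda>t. \<Sum>\<^sub>\<infinity>k. f (t, k)) ts)) {ss. map fst ss = ts}"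
    by (intro has_sum_cmult_right has_sum_prod_list f_summable)
  then show ?thesis
    by (rule has_sum_cong[THEN iffD1, rotated]) (auto simp: list_term_def)
qed

lemma list_term_type_majorant_has_sum:
  "((\<lambda>ts. norm (c (count_list ts)) / fact (length ts) * x ^ length ts) has_sum
     ps_majorant (egf_coeff c) x) UNIV"
proof (rule nonneg_has_sum_fibresI)
  have "0 \<le> x" by (rule order_trans[OF infsum_nonneg f_le]) simp
  then show "0 \<le> norm (c (count_list ts)) / fact (length ts) * x ^ length ts" for ts
    by simp
  show "((\<lambda>ts. norm (c (count_list ts)) / fact (length ts) * x ^ length ts) has_sum
     cmod (egf_coeff c \<beta>) * x ^ mdeg \<beta>) {ts. count_list ts = \<beta>}" for \<beta>
    using has_sum_lists_with_count[of "\<lambda>\<beta>. norm (c \<beta>)" "\<lambda>_. x" \<beta>]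
    by (simp add: egf_coeff_def norm_divide mdeg_def power_sum map_replicate_const)
qed (rule abs_conv_has_sum[OF c_conv])

lemma
  shows list_term_summable: "(\<lambda>ss. norm (list_term c f ss)) summable_on UNIV"
    and infsum_norm_list_term_le: "(\<Sum>\<^sub>\<infinity>ss. norm (list_term c f ss)) \<le> ps_majorant (egf_coeff c) x"
proof -
  let ?type_norm = "\<lambda>ts.
    norm (c (count_list ts)) / fact (length ts) * prod_list (map (\<lambda>t. \<Sum>\<^sub>\<infinity>k. norm (f (t, k))) ts)"
  have type_nonneg: "0 \<le> ?type_norm ts" for ts
    by (intro mult_nonneg_nonneg divide_nonneg_nonneg prod_list_nonneg) (auto intro: infsum_nonneg)
  have type_le: "?type_norm ts \<le> norm (c (count_list ts)) / fact (length ts) * x ^ length ts" for ts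
  proof (rule mult_left_mono)
    show "prod_list (map (\<lambda>t. \<Sum>\<^sub>\<infinity>k. norm (f (t, k))) ts) \<le> x ^ length ts"
      unfolding prod_list_eq_prod_count mdeg_count_list[symmetric] mdeg_def power_sum
      by (intro prod_mono conjI zero_le_power power_mono f_le infsum_nonneg norm_ge_zero)
  qed simp
  have types: "(?type_norm has_sum infsum ?type_norm UNIV) UNIV"
    by (intro has_sum_infsum summable_on_comparison_test[OF _ type_le type_nonneg]
          has_sum_imp_summable[OF list_term_type_majorant_has_sum])
  have total: "((\<lambda>ss. norm (list_term c f ss)) has_sum infsum ?type_norm UNIV) UNIV"
    by (rule nonneg_has_sum_fibresI[OF _ has_sum_norm_list_term_of_type types]) simp
  then show "(\<lambda>ss. norm (list_term c f ss)) summable_on UNIV"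
    by (rule has_sum_imp_summable)
  show "(\<Sum>\<^sub>\<infinity>ss. norm (list_term c f ss)) \<le> ps_majorant (egf_coeff c) x"
    unfolding infsumI[OF total] by (rule has_sum_mono[OF types list_term_type_majorant_has_sum type_le])
qed

lemma infsum_list_term:
  "infsum (list_term c f) UNIV = ps_eval (egf_coeff c) (\<lambda>t. \<Sum>\<^sub>\<infinity>k. f (t, k))"
proof -
  have "(list_term c f has_sum infsum (list_term c f) UNIV) UNIV"
    by (rule has_sum_infsum[OF abs_summable_summable[OF list_term_summable]])
  from has_sum_fibres[OF has_sum_fibres[OF this has_sum_list_term_of_type] has_sum_lists_with_count]
  show ?thesis
    unfolding ps_eval_def monom_def by (rule infsumI[symmetric])
qed

end

section \<open>Matrices with summable powers\<close>

lemma summable_submultiplicative: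
  fixes a :: "nat \<Rightarrow> real"
  assumes nonneg: "\<And>n. 0 \<le> a n" and submult: "\<And>m n. a (m + n) \<le> a m * a n" and "a \<longlonglongrightarrow> 0"
  shows "summable a"
proof -
  obtain p where contracting: "a p < 1 / 2"
    using order_tendstoD(2)[OF assms(3), of "1 / 2"] by (auto simp: eventually_sequentially)
  have "(\<Sum>k<N. a k) \<le> 2 * (\<Sum>k<p. a k)" for N
  proof -
    have "(\<Sum>k<N. a k) \<le> (\<Sum>k<N + p. a k)"
      by (rule sum_mono2) (auto simp: nonneg)
    also have "\<dots> = (\<Sum>k<p. a k) + (\<Sum>k<N. a (k + p))"
      by (induction N) simp_all
    also have "(\<Sum>k<N. a (k + p)) \<le> (\<Sum>k<N. a k * (1 / 2))"
      using contracting by (intro sum_mono order_trans[OF submult] mult_left_mono) (auto simp: nonneg)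
    also have "\<dots> = (\<Sum>k<N. a k) / 2" by (simp add: sum_divide_distrib)
    finally show ?thesis by simp
  qed
  then show ?thesis by (rule summableI_nonneg_bounded[OF nonneg])
qed

definition l1_norm :: "'a::real_normed_vector ^ 'n \<Rightarrow> real" where
  "l1_norm x = (\<Sum>i\<in>UNIV. norm (x $ i))"

definition entry_norm :: "'a::real_normed_vector ^ 'n ^ 'm \<Rightarrow> real" where
  "entry_norm A = (\<Sum>i\<in>UNIV. \<Sum>j\<in>UNIV. norm (A $ i $ j))"

lemma l1_norm_nonneg: "0 \<le> l1_norm x"
  by (simp add: l1_norm_def sum_nonneg)

lemma norm_nth_le_l1_norm: "norm (x $ i) \<le> l1_norm x"
  unfolding l1_norm_def by (rule member_le_sum) auto

lemma l1_norm_triangle: "l1_norm (x + y) \<le> l1_norm x + l1_norm y"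
  by (simp add: l1_norm_def norm_triangle_ineq sum_mono flip: sum.distrib)

lemma entry_norm_nonneg: "0 \<le> entry_norm A"
  by (simp add: entry_norm_def sum_nonneg)

lemma l1_norm_matrix_vector_mult:
  fixes A :: "'a::real_normed_field ^ 'n ^ 'm"
  shows "l1_norm (A *v x) \<le> entry_norm A * l1_norm x"
proof -
  have "l1_norm (A *v x) \<le> (\<Sum>i\<in>UNIV. \<Sum>j\<in>UNIV. norm (A $ i $ j) * norm (x $ j))"
    unfolding l1_norm_def matrix_vector_mult_def
    by (auto intro!: sum_mono norm_sum[THEN order_trans] simp: norm_mult)
  also have "\<dots> \<le> (\<Sum>i\<in>UNIV. \<Sum>j\<in>UNIV. norm (A $ i $ j) * l1_norm x)"
    by (intro sum_mono mult_left_mono norm_nth_le_l1_norm) simp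
  finally show ?thesis by (simp add: entry_norm_def sum_distrib_right)
qed

lemma entry_norm_eq_sum_l1_norm_columns: "entry_norm A = (\<Sum>j\<in>UNIV. l1_norm (column j A))"
  unfolding entry_norm_def l1_norm_def column_def by (subst sum.swap) simp

lemma entry_norm_matrix_mult:
  fixes A :: "'a::real_normed_field ^ 'n ^ 'm"
  shows "entry_norm (A ** B) \<le> entry_norm A * entry_norm B"
proof -
  have "column j (A ** B) = A *v column j B" for j
    by (simp add: column_def matrix_matrix_mult_def matrix_vector_mult_def)
  then show ?thesis
    by (simp add: entry_norm_eq_sum_l1_norm_columns[of B] entry_norm_eq_sum_l1_norm_columns[of "A ** B"]
          sum_distrib_left sum_mono l1_norm_matrix_vector_mult)
qed

lemma mpow_add: "mpow A (m + n) = mpow A m ** mpow A n"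
  by (induction n) (simp_all add: matrix_mul_assoc)

lemma summable_entry_norm_mpow:
  fixes A :: "'a::real_normed_field ^ 'n ^ 'n"
  assumes "summable (mpow A)"
  shows "summable (\<lambda>k. entry_norm (mpow A k))"
proof (rule summable_submultiplicative)
  show "entry_norm (mpow A (m + n)) \<le> entry_norm (mpow A m) * entry_norm (mpow A n)" for m n
    unfolding mpow_add by (rule entry_norm_matrix_mult)
  have "(\<lambda>k. entry_norm (mpow A k)) \<longlonglongrightarrow> (\<Sum>i\<in>UNIV. \<Sum>j\<in>UNIV. norm ((0 :: 'a ^ 'n ^ 'n) $ i $ j))"
    unfolding entry_norm_def using summable_LIMSEQ_zero[OF assms] by (intro tendsto_intros)
  then show "(\<lambda>k. entry_norm (mpow A k)) \<longlonglongrightarrow> 0" by simp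
qed (rule entry_norm_nonneg)

definition mpow_norm_sum :: "'a::real_normed_field ^ 'n ^ 'n \<Rightarrow> real" where
  "mpow_norm_sum A = (\<Sum>k. entry_norm (mpow A k))"

text \<open>A Lyapunov norm: applying \<open>A\<close> decreases it by exactly the \<open>l1_norm\<close>, so that sums of
  \<open>l1_norm\<close> along a recurrence telescope.\<close>

definition orbit_norm :: "'a::real_normed_field ^ 'n ^ 'n \<Rightarrow> 'a ^ 'n \<Rightarrow> real" where
  "orbit_norm A x = (\<Sum>k. l1_norm (mpow A k *v x))"

context
  fixes A :: "'a::real_normed_field ^ 'n ^ 'n"
  assumes summable_mpow: "summable (mpow A)"
begin

lemma mpow_norm_sum_nonneg: "0 \<le> mpow_norm_sum A"
  unfolding mpow_norm_sum_def
  by (intro suminf_nonneg summable_entry_norm_mpow summable_mpow entry_norm_nonneg)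

lemma
  shows summable_orbit: "summable (\<lambda>k. l1_norm (mpow A k *v x))"
    and orbit_norm_le: "orbit_norm A x \<le> mpow_norm_sum A * l1_norm x"
proof -
  have majorant: "summable (\<lambda>k. entry_norm (mpow A k) * l1_norm x)"
    by (intro summable_mult2 summable_entry_norm_mpow summable_mpow)
  show orbit: "summable (\<lambda>k. l1_norm (mpow A k *v x))"
    by (rule summable_comparison_test'[OF majorant]) (simp add: l1_norm_nonneg l1_norm_matrix_vector_mult)
  show "orbit_norm A x \<le> mpow_norm_sum A * l1_norm x"
    unfolding orbit_norm_def mpow_norm_sum_def suminf_mult2[OF summable_entry_norm_mpow[OF summable_mpow]]
    by (intro suminf_le l1_norm_matrix_vector_mult orbit majorant)
qed

lemma orbit_norm_nonneg: "0 \<le> orbit_norm A x"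
  unfolding orbit_norm_def by (intro suminf_nonneg summable_orbit l1_norm_nonneg)

lemma orbit_norm_triangle: "orbit_norm A (x + y) \<le> orbit_norm A x + orbit_norm A y"
  unfolding orbit_norm_def suminf_add[OF summable_orbit summable_orbit] matrix_vector_right_distrib
  by (intro suminf_le l1_norm_triangle summable_add summable_orbit)
    (use summable_orbit[of "x + y"] in \<open>simp add: matrix_vector_right_distrib\<close>)

lemma orbit_norm_matrix_vector_mult: "orbit_norm A (A *v x) = orbit_norm A x - l1_norm x"
  using suminf_split_head[OF summable_orbit[of x]]
  by (simp add: orbit_norm_def matrix_vector_mul_assoc)

lemma orbit_norm_affine_le:
  "l1_norm x + orbit_norm A (A *v x + q) \<le> orbit_norm A x + mpow_norm_sum A * l1_norm q"
  using orbit_norm_triangle[of "A *v x" q] orbit_norm_matrix_vector_mult[of x] orbit_norm_le[of q]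
  by linarith

lemma linear_recurrence_bound:
  assumes rec: "\<And>m. v (Suc m) = A *v v m + e m"
  shows "(\<Sum>m\<le>N. l1_norm (v m)) \<le> mpow_norm_sum A * (l1_norm (v 0) + (\<Sum>m<N. l1_norm (e m)))"
proof -
  have "(\<Sum>m<N. l1_norm (v m)) + orbit_norm A (v N)
      \<le> mpow_norm_sum A * (l1_norm (v 0) + (\<Sum>m<N. l1_norm (e m)))" for N
  proof (induction N)
    case (Suc N)
    then show ?case
      using orbit_norm_affine_le[of "v N" "e N"] by (simp add: rec distrib_left)
  qed (simp add: orbit_norm_le)
  from this[of N] show ?thesis
    using orbit_norm_matrix_vector_mult[of "v N"] orbit_norm_nonneg[of "A *v v N"]
    by (simp flip: lessThan_Suc_atMost)
qed

lemma affine_fixpoint_bound: "x = A *v x + q \<Longrightarrow> l1_norm x \<le> mpow_norm_sum A * l1_norm q"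
  using orbit_norm_affine_le[of x q] by simp

end

section \<open>Classes of trees\<close>

text \<open>The tree sum need not converge absolutely: only \<open>\<Sum>k. A ^ k\<close>, not the same series
  for \<open>|A|\<close>, converges. Grouping the trees by root type, leaf counts and number of vertices lets the
  cancellation take place inside the finitely many trees of each class.\<close>

type_synonym 'n tree_class = "'n \<times> ('n \<Rightarrow> nat) \<times> nat"

definition tindex :: "'n ttree \<Rightarrow> ('n \<Rightarrow> nat) \<times> nat" where
  "tindex T = (leafcnt T, nverts T)"

definition tclass :: "'n ttree \<Rightarrow> 'n tree_class" where
  "tclass T = (ttype T, tindex T)"

definition class_weight :: "('n \<Rightarrow> ('n \<Rightarrow> nat) \<Rightarrow> complex) \<Rightarrow> 'n tree_class \<Rightarrow> complex" where
  "class_weight H s = (\<Sum>T | tclass T = s. tweight H T)"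

definition forests :: "('n \<Rightarrow> nat) \<times> nat \<Rightarrow> 'n tree_class list set" where
  "forests k = map tclass ` {cs. (\<Sum>c\<leftarrow>cs. tindex c) = k}"

lemma snd_sum_list: "snd (sum_list ps) = (\<Sum>p\<leftarrow>ps. snd p)"
  by (induction ps) auto

lemma tindex_leaf: "tindex (Node t []) = (unitidx t, 1)"
  by (auto simp: tindex_def unitidx_def)

lemma tindex_Node:
  assumes "cs \<noteq> []"
  shows "tindex (Node t cs) = (\<Sum>c\<leftarrow>cs. tindex c) + (0, 1)"
proof -
  have "(\<Sum>c\<leftarrow>cs. tindex c) = (\<lambda>j. \<Sum>c\<leftarrow>cs. leafcnt c j, \<Sum>c\<leftarrow>cs. nverts c)"
    by (induction cs) (auto simp: tindex_def zero_prod_def fun_eq_iff)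
  then show ?thesis using assms by (auto simp: tindex_def)
qed

lemma nverts_pos: "0 < nverts T"
  by (cases T) simp

lemma length_le_sum_nverts: "length cs \<le> (\<Sum>c\<leftarrow>cs. nverts c)"
proof (induction cs)
  case (Cons c cs)
  then show ?case using nverts_pos[of c] by simp
qed simp

lemma leafcnt_neq_0: "leafcnt T \<noteq> 0"
proof (induction T)
  case (Node t cs)
  show ?case
  proof (cases cs)
    case Nil
    then have "leafcnt (Node t cs) t \<noteq> 0" by simp
    then show ?thesis by (metis zero_fun_apply)
  next
    case (Cons c cs')
    then obtain j where "leafcnt c j \<noteq> 0" using Node[of c] by (auto simp: fun_eq_iff)
    then have "leafcnt (Node t cs) j \<noteq> 0" using Cons by simp
    then show ?thesis by (metis zero_fun_apply)
  qed
qed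

lemma finite_nverts_le: "finite {T :: 'n::finite ttree. nverts T \<le> N}"
proof (induction N)
  case 0
  have "{T :: 'n ttree. nverts T \<le> 0} = {}" using nverts_pos by (auto simp del: nverts.simps)
  then show ?case by (simp only: finite.emptyI)
next
  case (Suc N)
  let ?small = "{T :: 'n ttree. nverts T \<le> N}"
  have "{T. nverts T \<le> Suc N} \<subseteq> (\<lambda>(t, cs). Node t cs) ` (UNIV \<times> {cs. set cs \<subseteq> ?small \<and> length cs \<le> N})"
  proof
    fix T :: "'n ttree"
    assume T: "T \<in> {T. nverts T \<le> Suc N}"
    obtain t cs where Node: "T = Node t cs" by (cases T)
    have total: "(\<Sum>c\<leftarrow>cs. nverts c) \<le> N" using T Node by simp
    moreover have "nverts c \<le> (\<Sum>c\<leftarrow>cs. nverts c)" if "c \<in> set cs" for c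
      using that by (intro member_le_sum_list) auto
    ultimately show "T \<in> (\<lambda>(t, cs). Node t cs) ` (UNIV \<times> {cs. set cs \<subseteq> ?small \<and> length cs \<le> N})"
      using Node length_le_sum_nverts[of cs] by force
  qed
  then show ?case
    by (rule finite_subset) (intro finite_imageI finite_cartesian_product finite_lists_length_le Suc; simp)
qed

lemma finite_tree_lists: "finite {cs :: 'n::finite ttree list. (\<Sum>c\<leftarrow>cs. tindex c) = k}"
proof -
  have "nverts (Node t cs) \<le> Suc (snd k)" if "(\<Sum>c\<leftarrow>cs. tindex c) = k" for t and cs :: "'n ttree list"
    using snd_sum_list[of "map tindex cs"] that by (simp add: tindex_def o_def)
  then have "finite (Node undefined ` {cs :: 'n ttree list. (\<Sum>c\<leftarrow>cs. tindex c) = k})"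
    by (intro finite_subset[OF _ finite_nverts_le[of "Suc (snd k)"]]) blast
  then show ?thesis by (rule finite_imageD) (auto simp: inj_on_def)
qed

lemma finite_forests: "finite (forests k :: 'n::finite tree_class list set)"
  unfolding forests_def by (intro finite_imageI finite_tree_lists)

lemma sum_list_forests:
  assumes "ss \<in> forests k"
  shows "sum_list (map snd ss) = k"
  using assms by (auto simp: forests_def tclass_def o_def)

lemma class_weight_no_vertices [simp]: "class_weight H (i, \<alpha>, 0) = 0"
  unfolding class_weight_def tclass_def tindex_def
  by (rule sum.neutral) (auto simp: nverts_pos[THEN gr_implies_not0])

lemma class_weight_no_leaves [simp]: "class_weight H (i, 0, m) = 0"
  unfolding class_weight_def tclass_def tindex_def
  by (rule sum.neutral) (auto simp: leafcnt_neq_0)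

lemma gpartial_eq_sum_class_weight: "gpartial H i \<alpha> N = (\<Sum>m\<le>N. class_weight H (i, \<alpha>, m))"
proof -
  let ?X = "{T \<in> Strees i \<alpha>. nverts T \<le> N}"
  have "finite ?X" by (rule finite_subset[OF _ finite_nverts_le[of N]]) auto
  then have "gpartial H i \<alpha> N = (\<Sum>m\<in>{..N}. \<Sum>T | T \<in> ?X \<and> nverts T = m. tweight H T)"
    unfolding gpartial_def by (intro sum.group[symmetric]) auto
  also have "\<dots> = (\<Sum>m\<le>N. class_weight H (i, \<alpha>, m))"
    unfolding class_weight_def by (intro sum.cong) (auto simp: tclass_def tindex_def Strees_def)
  finally show ?thesis .
qed

lemma prod_list_class_weight:
  "prod_list (map (class_weight H) ss) = (\<Sum>cs | map tclass cs = ss. prod_list (map (tweight H) cs))"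
proof (induction ss)
  case (Cons s ss)
  have lists: "{cs. map tclass cs = s # ss}
      = (\<lambda>(T, cs). T # cs) ` ({T. tclass T = s} \<times> {cs. map tclass cs = ss})"
    by (auto simp: map_eq_Cons_conv)
  have "(\<Sum>cs | map tclass cs = s # ss. prod_list (map (tweight H) cs))
      = (\<Sum>(T, cs)\<in>{T. tclass T = s} \<times> {cs. map tclass cs = ss}.
            tweight H T * prod_list (map (tweight H) cs))"
    unfolding lists by (subst sum.reindex) (auto simp: inj_on_def intro!: sum.cong)
  then show ?case
    by (simp add: Cons class_weight_def[of H s] sum_product sum.cartesian_product)
qed simp

lemma prod_list_class_weight_eq_0:
  assumes "ss \<notin> forests (sum_list (map snd ss))"
  shows "prod_list (map (class_weight H) ss) = 0"
proof -
  have "{cs. map tclass cs = ss} = {}"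
    using assms by (auto simp: forests_def tclass_def o_def)
  then show ?thesis by (simp add: prod_list_class_weight)
qed

lemma mu_eq_count_list: "mu cs = count_list (map ttype cs)"
proof
  show "mu cs j = count_list (map ttype cs) j" for j
    by (induction cs) (auto simp: mu_def)
qed

lemma list_term_class_weight:
  assumes "ss \<noteq> []"
  shows "list_term (H i) (class_weight H) ss = (\<Sum>cs | map tclass cs = ss. tweight H (Node i cs))"
proof -
  have "tweight H (Node i cs)
      = H i (count_list (map fst ss)) / fact (length ss) * prod_list (map (tweight H) cs)"
    if "map tclass cs = ss" for cs
    using that assms by (auto simp: mu_eq_count_list tclass_def o_def)
  then show ?thesis
    by (simp add: list_term_def prod_list_class_weight sum_distrib_left)
qed

definition leaf_weight :: "'n \<Rightarrow> ('n \<Rightarrow> nat) \<times> nat \<Rightarrow> complex" where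
  "leaf_weight i k = of_bool (k = (unitidx i, 0))"

lemma class_weight_Suc_forests:
  fixes i :: "'n::finite"
  shows "class_weight H (i, fst k, Suc (snd k)) =
    leaf_weight i k + (\<Sum>ss\<in>forests k - {[]}. list_term (H i) (class_weight H) ss)"
proof -
  let ?C = "{cs :: 'n ttree list. (\<Sum>c\<leftarrow>cs. tindex c) = k} - {[]}"
  let ?leaf = "if k = (unitidx i, 0) then {Node i []} else {}"
  have "T \<in> {T. tclass T = (i, fst k, Suc (snd k))} \<longleftrightarrow> T \<in> Node i ` ?C \<union> ?leaf" for T
  proof (cases T)
    case (Node t cs)
    then show ?thesis
      by (cases "cs = []") (auto simp: tclass_def tindex_leaf tindex_Node prod_eq_iff)
  qed
  then have "class_weight H (i, fst k, Suc (snd k)) = sum (tweight H) (Node i ` ?C \<union> ?leaf)"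
    unfolding class_weight_def by (intro sum.cong) auto
  also have "\<dots> = sum (tweight H) (Node i ` ?C) + sum (tweight H) ?leaf"
    by (rule sum.union_disjoint) (auto simp: finite_tree_lists)
  also have "sum (tweight H) ?leaf = leaf_weight i k" by (simp add: leaf_weight_def)
  also have "sum (tweight H) (Node i ` ?C) = (\<Sum>cs\<in>?C. tweight H (Node i cs))"
    by (subst sum.reindex) (auto simp: inj_on_def)
  also have "\<dots> = (\<Sum>ss\<in>map tclass ` ?C. \<Sum>cs | cs \<in> ?C \<and> map tclass cs = ss. tweight H (Node i cs))"
    by (rule sum.image_gen) (simp add: finite_tree_lists)
  also have "\<dots> = (\<Sum>ss\<in>forests k - {[]}. list_term (H i) (class_weight H) ss)"
  proof (rule sum.cong)
    show "map tclass ` ?C = forests k - {[]}" by (auto simp: forests_def)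
    fix ss assume ss: "ss \<in> forests k - {[]}"
    have "{cs. cs \<in> ?C \<and> map tclass cs = ss} = {cs. map tclass cs = ss}"
      using ss sum_list_forests[of ss k] by (auto simp: tclass_def o_def)
    then show "(\<Sum>cs | cs \<in> ?C \<and> map tclass cs = ss. tweight H (Node i cs))
        = list_term (H i) (class_weight H) ss"
      using ss by (simp add: list_term_class_weight)
  qed
  finally show ?thesis by simp
qed

definition higher :: "(('n::finite \<Rightarrow> nat) \<Rightarrow> 'a::zero) \<Rightarrow> ('n \<Rightarrow> nat) \<Rightarrow> 'a" where
  "higher c \<beta> = (if 2 \<le> mdeg \<beta> then c \<beta> else 0)"

definition branch_weight :: "('n::finite \<Rightarrow> ('n \<Rightarrow> nat) \<Rightarrow> complex) \<Rightarrow> 'n \<Rightarrow> ('n \<Rightarrow> nat) \<times> nat \<Rightarrow> complex" where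
  "branch_weight H i k = (\<Sum>ss\<in>forests k. list_term (higher (H i)) (class_weight H) ss)"

lemma list_term_higher: "list_term (higher c) f ss = (if 2 \<le> length ss then list_term c f ss else 0)"
  using mdeg_count_list[of "map fst ss"] by (simp add: list_term_def higher_def)

lemma list_term_singleton: "list_term c f [(j, k)] = c (unitidx j) * f (j, k)"
proof -
  have "count_list [j] = unitidx j" by (auto simp: unitidx_def)
  then show ?thesis by (simp add: list_term_def del: count_list.simps)
qed

lemma sum_singleton_forests:
  fixes k :: "('n::finite \<Rightarrow> nat) \<times> nat"
  shows "(\<Sum>ss | ss \<in> forests k \<and> length ss = 1. list_term c (class_weight H) ss)
    = (\<Sum>j\<in>UNIV. c (unitidx j) * class_weight H (j, k))"
proof -
  have singleton_forest: "[(j, k)] \<in> forests k" if "class_weight H (j, k) \<noteq> 0" for j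
    using prod_list_class_weight_eq_0[of "[(j, k)]" H] that by auto
  have "(\<Sum>ss | ss \<in> forests k \<and> length ss = 1. list_term c (class_weight H) ss)
      = (\<Sum>ss\<in>range (\<lambda>j. [(j, k)]). list_term c (class_weight H) ss)"
  proof (rule sum.mono_neutral_left)
    show "{ss \<in> forests k. length ss = 1} \<subseteq> range (\<lambda>j. [(j, k)])"
      by (auto simp: length_Suc_conv dest!: sum_list_forests)
    show "\<forall>ss\<in>range (\<lambda>j. [(j, k)]) - {ss \<in> forests k. length ss = 1}. list_term c (class_weight H) ss = 0"
      using singleton_forest by (auto simp: list_term_singleton)
  qed simp
  also have "\<dots> = (\<Sum>j\<in>UNIV. c (unitidx j) * class_weight H (j, k))"
    by (subst sum.reindex) (auto simp: inj_on_def list_term_singleton)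
  finally show ?thesis .
qed

lemma class_weight_Suc:
  fixes i :: "'n::finite"
  shows "class_weight H (i, fst k, Suc (snd k)) =
    (\<Sum>j\<in>UNIV. H i (unitidx j) * class_weight H (j, k)) + (leaf_weight i k + branch_weight H i k)"
proof -
  let ?F = "forests k :: 'n tree_class list set"
  let ?term = "list_term (H i) (class_weight H)"
  have "ss \<noteq> [] \<longleftrightarrow> length ss = 1 \<or> 2 \<le> length ss" for ss :: "'n tree_class list"
    unfolding length_greater_0_conv[symmetric] by presburger
  then have "?F - {[]} = {ss \<in> ?F. length ss = 1} \<union> {ss \<in> ?F. 2 \<le> length ss}"
    by auto
  then have "sum ?term (?F - {[]}) = sum ?term ({ss \<in> ?F. length ss = 1} \<union> {ss \<in> ?F. 2 \<le> length ss})"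
    by (rule arg_cong)
  also have "\<dots> = (\<Sum>ss | ss \<in> ?F \<and> length ss = 1. ?term ss) + (\<Sum>ss | ss \<in> ?F \<and> 2 \<le> length ss. ?term ss)"
    by (rule sum.union_disjoint) (auto simp: finite_forests)
  also have "(\<Sum>ss | ss \<in> ?F \<and> 2 \<le> length ss. ?term ss) = branch_weight H i k"
    unfolding branch_weight_def list_term_higher by (rule sum.inter_filter[OF finite_forests])
  finally show ?thesis
    unfolding class_weight_Suc_forests sum_singleton_forests by (simp only: ac_simps)
qed

lemma list_term_mult_monom:
  assumes "\<And>s. s \<in> set ss \<Longrightarrow> f s = w s * monom z (fst (snd s))"
  shows "list_term c f ss = list_term c w ss * monom z (fst (sum_list (map snd ss)))"
proof -
  have "prod_list (map f ss) = prod_list (map w ss) * monom z (fst (sum_list (map snd ss)))"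
    using assms by (induction ss) (auto simp: monom_add)
  then show ?thesis by (simp add: list_term_def)
qed

lemma has_sum_branch_weight:
  fixes k :: "('n::finite \<Rightarrow> nat) \<times> nat"
  assumes f: "\<And>s. snd (snd s) \<le> snd k \<Longrightarrow> f s = class_weight H s * monom z (fst (snd s))"
  shows "(list_term (higher (H i)) f has_sum branch_weight H i k * monom z (fst k))
    {ss. sum_list (map snd ss) = k}"
proof -
  have term_eq: "list_term (higher (H i)) f ss
      = list_term (higher (H i)) (class_weight H) ss * monom z (fst k)"
    if total: "sum_list (map snd ss) = k" for ss
  proof -
    have "snd (snd s) \<le> snd k" if "s \<in> set ss" for s
      unfolding total[symmetric] snd_sum_list using that by (intro member_le_sum_list) auto
    then show ?thesis using list_term_mult_monom[of ss f, OF f] by (simp add: total)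
  qed
  have "branch_weight H i k * monom z (fst k) = sum (list_term (higher (H i)) f) (forests k)"
    unfolding branch_weight_def sum_distrib_right
    by (rule sum.cong) (auto simp: term_eq dest: sum_list_forests)
  moreover have "list_term (higher (H i)) f ss = 0" if "sum_list (map snd ss) = k" "ss \<notin> forests k" for ss
    using that prod_list_class_weight_eq_0[of ss H] by (simp add: term_eq) (simp add: list_term_def)
  ultimately show ?thesis
    by (intro has_sum_finite_neutralI[OF finite_forests]) (auto dest: sum_list_forests)
qed

section \<open>The linear and the nonlinear part of the map\<close>

definition nonlin :: "('n::finite \<Rightarrow> ('n \<Rightarrow> nat) \<Rightarrow> complex) \<Rightarrow> 'n \<Rightarrow> ('n \<Rightarrow> nat) \<Rightarrow> complex" where
  "nonlin H i = egf_coeff (higher (H i))"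

lemma nonlin_eq_0: "mdeg \<beta> < 2 \<Longrightarrow> nonlin H i \<beta> = 0"
  by (simp add: nonlin_def egf_coeff_def higher_def)

lemma Fcoeff_0: "Fcoeff H i 0 = 0"
proof -
  have "unitidx i i \<noteq> 0" by (simp add: unitidx_def)
  then have "0 \<noteq> unitidx i" by (metis zero_fun_apply)
  then show ?thesis by (simp add: Fcoeff_def flip: func_zero)
qed

lemma Fcoeff_unitidx: "Fcoeff H i (unitidx j) = of_bool (j = i) - H i (unitidx j)"
proof -
  have "unitidx j \<noteq> 0" using mdeg_eq_0_iff[of "unitidx j"] by auto
  then show ?thesis by (simp add: Fcoeff_def inj_eq[OF inj_unitidx] flip: func_zero)
qed

lemma Fcoeff_higher:
  assumes "2 \<le> mdeg \<beta>"
  shows "Fcoeff H i \<beta> = - nonlin H i \<beta>"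
proof -
  have "\<beta> \<noteq> unitidx i" "\<beta> \<noteq> 0" using assms mdeg_eq_0_iff[of \<beta>] by auto
  then show ?thesis
    using assms by (simp add: Fcoeff_def nonlin_def egf_coeff_def higher_def flip: func_zero)
qed

lemma abs_conv_nonlin:
  assumes "abs_conv (Fcoeff H i) x" and "0 \<le> x"
  shows "abs_conv (nonlin H i) x"
  unfolding abs_conv_def
proof (rule summable_on_comparison_test[OF assms(1)[unfolded abs_conv_def]])
  show "cmod (nonlin H i \<beta>) * x ^ mdeg \<beta> \<le> cmod (Fcoeff H i \<beta>) * x ^ mdeg \<beta>" for \<beta>
    using assms(2) by (cases "2 \<le> mdeg \<beta>") (simp_all add: Fcoeff_higher nonlin_eq_0)
qed (use assms(2) in simp)

lemma map_eval_Fcoeff: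
  assumes conv: "abs_conv (Fcoeff H i) x" and v_le: "\<And>j. cmod (v j) \<le> x"
  shows "map_eval (Fcoeff H) v i = v i - (\<Sum>j\<in>UNIV. H i (unitidx j) * v j) - ps_eval (nonlin H i) v"
proof -
  have "0 \<le> x" using v_le norm_ge_zero order_trans by blast
  have "((\<lambda>\<beta>. Fcoeff H i \<beta> * monom v \<beta> + nonlin H i \<beta> * monom v \<beta>) has_sum
      map_eval (Fcoeff H) v i + ps_eval (nonlin H i) v) UNIV"
    unfolding map_eval_def
    by (intro has_sum_add abs_conv_imp_has_sum[OF _ v_le] conv abs_conv_nonlin \<open>0 \<le> x\<close>)
  moreover have "((\<lambda>\<beta>. Fcoeff H i \<beta> * monom v \<beta> + nonlin H i \<beta> * monom v \<beta>) has_sum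
      v i - (\<Sum>j\<in>UNIV. H i (unitidx j) * v j)) UNIV"
  proof (rule has_sum_finite_neutralI[of "range unitidx"])
    fix \<beta> :: "'a \<Rightarrow> nat"
    assume "\<beta> \<in> UNIV - range unitidx"
    then consider "\<beta> = 0" | "2 \<le> mdeg \<beta>"
      using mdeg_eq_0_iff[of \<beta>] mdeg_eq_1D[of \<beta>] by fastforce
    then show "Fcoeff H i \<beta> * monom v \<beta> + nonlin H i \<beta> * monom v \<beta> = 0"
      by cases (simp_all add: Fcoeff_0 Fcoeff_higher nonlin_eq_0 mdeg_eq_0_iff[THEN iffD2])
  next
    show "v i - (\<Sum>j\<in>UNIV. H i (unitidx j) * v j)
      = (\<Sum>\<beta>\<in>range unitidx. Fcoeff H i \<beta> * monom v \<beta> + nonlin H i \<beta> * monom v \<beta>)"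
      by (simp add: sum.reindex[OF inj_unitidx] Fcoeff_unitidx nonlin_eq_0 left_diff_distrib sum_subtractf)
  qed auto
  ultimately have "map_eval (Fcoeff H) v i + ps_eval (nonlin H i) v
      = v i - (\<Sum>j\<in>UNIV. H i (unitidx j) * v j)"
    by (rule has_sum_unique)
  then show ?thesis by (simp add: eq_diff_eq)
qed

section \<open>Convergence of the tree series\<close>

definition class_vector :: "('n::finite \<Rightarrow> ('n \<Rightarrow> nat) \<Rightarrow> complex) \<Rightarrow> ('n \<Rightarrow> nat) \<times> nat \<Rightarrow> complex ^ 'n" where
  "class_vector H k = (\<chi> i. class_weight H (i, k))"

definition source_vector :: "('n::finite \<Rightarrow> ('n \<Rightarrow> nat) \<Rightarrow> complex) \<Rightarrow> ('n \<Rightarrow> nat) \<times> nat \<Rightarrow> complex ^ 'n" where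
  "source_vector H k = (\<chi> i. leaf_weight i k + branch_weight H i k)"

definition class_term ::
  "('n::finite \<Rightarrow> ('n \<Rightarrow> nat) \<Rightarrow> complex) \<Rightarrow> ('n \<Rightarrow> complex) \<Rightarrow> 'n tree_class \<Rightarrow> complex" where
  "class_term H z s = class_weight H s * monom z (fst (snd s))"

definition tree_coeff :: "('n::finite \<Rightarrow> ('n \<Rightarrow> nat) \<Rightarrow> complex) \<Rightarrow> 'n \<Rightarrow> ('n \<Rightarrow> nat) \<Rightarrow> complex" where
  "tree_coeff H i \<alpha> = (\<Sum>\<^sub>\<infinity>m. class_weight H (i, \<alpha>, m))"

lemma tree_coeff_0: "tree_coeff H i 0 = 0"
  by (simp add: tree_coeff_def)

lemma class_vector_Suc:
  "class_vector H (\<alpha>, Suc m) = linmat H *v class_vector H (\<alpha>, m) + source_vector H (\<alpha>, m)"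
  using class_weight_Suc[of H _ "(\<alpha>, m)"]
  by (simp add: vec_eq_iff class_vector_def source_vector_def linmat_def matrix_vector_mult_def)

lemma ex_pos_mult_le:
  fixes a b k :: real
  assumes "0 < a" "0 < b"
  shows "\<exists>r>0. r \<le> a \<and> k * r \<le> b"
proof (cases "0 < k")
  case True
  then show ?thesis
    using assms mult_left_mono[of "min a (b / k)" "b / k" k] by (intro exI[of _ "min a (b / k)"]) auto
next
  case False
  then show ?thesis
    using assms mult_nonpos_nonneg[of k a] by (intro exI[of _ a]) auto
qed

locale inversion_radius =
  fixes H :: "'n::finite \<Rightarrow> ('n \<Rightarrow> nat) \<Rightarrow> complex" and \<rho> :: real
  assumes summable_mpow: "summable (mpow (linmat H))"
    and radius_pos: "0 < \<rho>"
    and Fcoeff_conv: "\<And>i. abs_conv (Fcoeff H i) \<rho>"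
    and nonlin_majorant_le: "mpow_norm_sum (linmat H) * (\<Sum>i\<in>UNIV. ps_majorant (nonlin H i) \<rho>) \<le> \<rho> / 2"
    and nonlin_contraction: "\<And>v w \<delta>. \<lbrakk>\<And>j. cmod (v j) \<le> \<rho>; \<And>j. cmod (w j) \<le> \<rho>; \<And>j. cmod (v j - w j) \<le> \<delta>\<rbrakk> \<Longrightarrow>
      mpow_norm_sum (linmat H) * (\<Sum>i\<in>UNIV. cmod (ps_eval (nonlin H i) v - ps_eval (nonlin H i) w)) \<le> \<delta> / 2"
begin

abbreviation C :: real where
  "C \<equiv> mpow_norm_sum (linmat H)"

definition small :: "('n \<Rightarrow> complex) \<Rightarrow> bool" where
  "small z \<longleftrightarrow> C * (\<Sum>j\<in>UNIV. cmod (z j)) \<le> \<rho> / 2"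

lemma C_nonneg: "0 \<le> C"
  by (rule mpow_norm_sum_nonneg[OF summable_mpow])

lemma nonlin_conv: "abs_conv (nonlin H i) \<rho>"
  using abs_conv_nonlin[OF Fcoeff_conv] radius_pos by simp

definition box_sum ::
  "('n \<Rightarrow> complex) \<Rightarrow> (('n \<Rightarrow> nat) \<times> nat \<Rightarrow> complex ^ 'n) \<Rightarrow> ('n \<Rightarrow> nat) set \<Rightarrow> nat \<Rightarrow> real" where
  "box_sum z V A N = (\<Sum>k\<in>A \<times> {..N}. l1_norm (V k) * cmod (monom z (fst k)))"

lemma box_sum_class_vector_0: "box_sum z (class_vector H) A 0 = 0"
  unfolding box_sum_def
  by (rule sum.neutral) (auto simp: class_vector_def l1_norm_def)

lemma box_sum_class_vector_Suc:
  "box_sum z (class_vector H) A (Suc N) \<le> C * box_sum z (source_vector H) A N"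
proof -
  have recurrence: "(\<Sum>m\<le>Suc N. l1_norm (class_vector H (\<alpha>, m)))
      \<le> C * (\<Sum>m\<le>N. l1_norm (source_vector H (\<alpha>, m)))" for \<alpha>
    using linear_recurrence_bound[where v = "\<lambda>m. class_vector H (\<alpha>, m)" and N = "Suc N",
        OF summable_mpow class_vector_Suc]
    by (simp only: lessThan_Suc_atMost) (simp add: class_vector_def l1_norm_def)
  have "box_sum z (class_vector H) A (Suc N)
      = (\<Sum>\<alpha>\<in>A. (\<Sum>m\<le>Suc N. l1_norm (class_vector H (\<alpha>, m))) * cmod (monom z \<alpha>))"
    by (simp only: box_sum_def sum_distrib_right sum.cartesian_product case_prod_unfold
          fst_conv prod.collapse)
  also have "\<dots> \<le> (\<Sum>\<alpha>\<in>A. C * (\<Sum>m\<le>N. l1_norm (source_vector H (\<alpha>, m))) * cmod (monom z \<alpha>))"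
    by (intro sum_mono mult_right_mono recurrence) simp
  also have "\<dots> = C * (\<Sum>\<alpha>\<in>A. (\<Sum>m\<le>N. l1_norm (source_vector H (\<alpha>, m))) * cmod (monom z \<alpha>))"
    by (subst sum_distrib_left) (simp only: mult.assoc)
  also have "\<dots> = C * box_sum z (source_vector H) A N"
    by (simp only: box_sum_def sum_distrib_right sum.cartesian_product case_prod_unfold
          fst_conv prod.collapse)
  finally show ?thesis .
qed

lemma sum_class_term_le_box_sum:
  "(\<Sum>k\<in>A \<times> {..N}. norm (class_term H z (i, k))) \<le> box_sum z (class_vector H) A N"
  unfolding box_sum_def
proof (rule sum_mono)
  fix k
  have "norm (class_term H z (i, k)) = cmod (class_vector H k $ i) * cmod (monom z (fst k))"
    by (simp add: class_term_def class_vector_def norm_mult)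
  also have "\<dots> \<le> l1_norm (class_vector H k) * cmod (monom z (fst k))"
    by (intro mult_right_mono norm_nth_le_l1_norm) simp
  finally show "norm (class_term H z (i, k)) \<le> l1_norm (class_vector H k) * cmod (monom z (fst k))" .
qed

lemma
  assumes "\<And>A. finite A \<Longrightarrow> box_sum z (class_vector H) A N \<le> \<rho>"
  shows truncated_class_term_summable:
      "(\<lambda>k. norm (if snd k \<le> N then class_term H z (i, k) else 0)) summable_on UNIV"
    and infsum_truncated_class_term_le:
      "(\<Sum>\<^sub>\<infinity>k. norm (if snd k \<le> N then class_term H z (i, k) else 0)) \<le> \<rho>"
proof -
  let ?f = "\<lambda>k. norm (if snd k \<le> N then class_term H z (i, k) else 0)"
  have boxes: "sum ?f (A \<times> {..M}) \<le> \<rho>" if "finite A" for A M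
  proof -
    have "sum ?f (A \<times> {..M}) = (\<Sum>k\<in>A \<times> {..min M N}. norm (class_term H z (i, k)))"
      using that by (intro sum.mono_neutral_cong_right) auto
    also have "\<dots> \<le> (\<Sum>k\<in>A \<times> {..N}. norm (class_term H z (i, k)))"
      using that by (intro sum_mono2) auto
    also have "\<dots> \<le> \<rho>"
      by (rule order_trans[OF sum_class_term_le_box_sum assms[OF that]])
    finally show ?thesis .
  qed
  show "?f summable_on UNIV" by (rule summable_on_boxesI[OF _ boxes]) auto
  show "infsum ?f UNIV \<le> \<rho>" by (rule infsum_boxes_le[OF _ boxes]) auto
qed

lemma branch_weights_le:
  assumes "\<And>A. finite A \<Longrightarrow> box_sum z (class_vector H) A N \<le> \<rho>" and "finite A"
  shows "(\<Sum>k\<in>A \<times> {..N}. cmod (branch_weight H i k * monom z (fst k))) \<le> ps_majorant (nonlin H i) \<rho>"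
proof -
  define f where "f s = (if snd (snd s) \<le> N then class_term H z s else 0)" for s
  have f_sums: "(\<lambda>k. norm (f (t, k))) summable_on UNIV" "(\<Sum>\<^sub>\<infinity>k. norm (f (t, k))) \<le> \<rho>" for t
    unfolding f_def snd_conv
    by (rule truncated_class_term_summable infsum_truncated_class_term_le, fact assms(1))+
  have "(\<Sum>k\<in>A \<times> {..N}. cmod (branch_weight H i k * monom z (fst k)))
      \<le> (\<Sum>\<^sub>\<infinity>ss. norm (list_term (higher (H i)) f ss))"
  proof (rule sum_norm_fibres_le)
    show "(\<lambda>ss. norm (list_term (higher (H i)) f ss)) summable_on UNIV"
      by (rule list_term_summable[OF f_sums nonlin_conv[unfolded nonlin_def]])
    show "(list_term (higher (H i)) f has_sum branch_weight H i k * monom z (fst k))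
        {ss. sum_list (map snd ss) = k}" if "k \<in> A \<times> {..N}" for k
      by (rule has_sum_branch_weight) (use that in \<open>auto simp: f_def class_term_def\<close>)
  qed (use assms(2) in simp)
  also have "\<dots> \<le> ps_majorant (nonlin H i) \<rho>"
    unfolding nonlin_def by (rule infsum_norm_list_term_le[OF f_sums nonlin_conv[unfolded nonlin_def]])
  finally show ?thesis .
qed

lemma leaf_weights_le:
  assumes "finite A"
  shows "(\<Sum>k\<in>A \<times> {..N}. cmod (leaf_weight i k * monom z (fst k))) \<le> cmod (z i)"
proof -
  have "(\<Sum>k\<in>A \<times> {..N}. cmod (leaf_weight i k * monom z (fst k)))
      = (\<Sum>k\<in>A \<times> {..N}. if k = (unitidx i, 0) then cmod (z i) else 0)"
    by (rule sum.cong) (auto simp: leaf_weight_def)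
  then show ?thesis using assms by simp
qed

text \<open>Chains of vertices with one child are absorbed by \<open>C\<close>; what remains is at least quadratic,
  so the bound \<open>\<rho>\<close> reproduces itself.\<close>

lemma box_sum_class_vector_le:
  assumes "small z" and "finite A"
  shows "box_sum z (class_vector H) A N \<le> \<rho>"
  using assms(2)
proof (induction N arbitrary: A)
  case 0
  then show ?case using radius_pos by (simp add: box_sum_class_vector_0)
next
  case (Suc N)
  have "box_sum z (source_vector H) A N
      \<le> (\<Sum>k\<in>A \<times> {..N}. \<Sum>i\<in>UNIV.
            cmod (leaf_weight i k * monom z (fst k)) + cmod (branch_weight H i k * monom z (fst k)))"
    unfolding box_sum_def l1_norm_def source_vector_def sum_distrib_right norm_mult
    by (intro sum_mono) (simp add: mult_right_mono norm_triangle_ineq flip: distrib_right)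
  also have "\<dots> = (\<Sum>i\<in>UNIV. (\<Sum>k\<in>A \<times> {..N}. cmod (leaf_weight i k * monom z (fst k)))
      + (\<Sum>k\<in>A \<times> {..N}. cmod (branch_weight H i k * monom z (fst k))))"
    by (subst sum.swap) (simp only: sum.distrib)
  also have "\<dots> \<le> (\<Sum>i\<in>UNIV. cmod (z i) + ps_majorant (nonlin H i) \<rho>)"
    by (intro sum_mono add_mono leaf_weights_le branch_weights_le Suc)
  finally have "C * box_sum z (source_vector H) A N
      \<le> C * (\<Sum>i\<in>UNIV. cmod (z i) + ps_majorant (nonlin H i) \<rho>)"
    using C_nonneg by (rule mult_left_mono)
  also have "\<dots> \<le> \<rho>"
    using assms(1) nonlin_majorant_le unfolding small_def sum.distrib distrib_left by linarith
  finally show ?case using box_sum_class_vector_Suc[of z A N] by linarith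
qed

lemma
  assumes "small z"
  shows class_term_summable: "(\<lambda>k. norm (class_term H z (i, k))) summable_on UNIV"
    and infsum_class_term_le: "(\<Sum>\<^sub>\<infinity>k. norm (class_term H z (i, k))) \<le> \<rho>"
proof -
  have boxes: "(\<Sum>k\<in>A \<times> {..N}. norm (class_term H z (i, k))) \<le> \<rho>" if "finite A" for A N
    by (rule order_trans[OF sum_class_term_le_box_sum box_sum_class_vector_le[OF assms that]])
  show "(\<lambda>k. norm (class_term H z (i, k))) summable_on UNIV"
    by (rule summable_on_boxesI[OF _ boxes]) auto
  show "(\<Sum>\<^sub>\<infinity>k. norm (class_term H z (i, k))) \<le> \<rho>"
    by (rule infsum_boxes_le[OF _ boxes]) auto
qed

lemma ex_small_polydisc: "\<exists>r>0. \<forall>z. (\<forall>j. cmod (z j) \<le> r) \<longrightarrow> small z"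
proof -
  obtain r where radius: "0 < r" "C * real CARD('n) * r \<le> \<rho> / 2"
    using ex_pos_mult_le[OF zero_less_one half_gt_zero[OF radius_pos]] by blast
  have "small z" if z_le: "\<forall>j. cmod (z j) \<le> r" for z
  proof -
    have "C * (\<Sum>j\<in>UNIV. cmod (z j)) \<le> C * (real CARD('n) * r)"
      using sum_bounded_above[of UNIV "\<lambda>j. cmod (z j)" r] z_le C_nonneg by (intro mult_left_mono) auto
    then show ?thesis using radius(2) by (simp add: small_def mult.assoc)
  qed
  then show ?thesis using radius(1) by blast
qed

lemma class_weight_has_sum: "((\<lambda>m. class_weight H (i, \<alpha>, m)) has_sum tree_coeff H i \<alpha>) UNIV"
proof -
  obtain r where r_pos: "0 < r" and small: "(\<forall>j. cmod (z j) \<le> r) \<Longrightarrow> small z" for z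
    using ex_small_polydisc by blast
  define z :: "'n \<Rightarrow> complex" where "z j = of_real r" for j
  have nonzero: "monom z \<alpha> \<noteq> 0" using r_pos by (simp add: monom_def z_def)
  have "small z" using r_pos by (intro small) (simp add: z_def)
  then have "(\<lambda>(\<alpha>, m). class_term H z (i, \<alpha>, m)) summable_on UNIV \<times> UNIV"
    using abs_summable_summable[OF class_term_summable] by (simp add: case_prod_unfold)
  then have "(\<lambda>m. class_term H z (i, \<alpha>, m)) summable_on UNIV"
    by (rule summable_on_SigmaD1) simp
  then have "(\<lambda>m. class_term H z (i, \<alpha>, m) * inverse (monom z \<alpha>)) summable_on UNIV"
    by (rule summable_on_cmult_left)
  then show ?thesis
    using nonzero by (simp add: tree_coeff_def class_term_def mult.assoc)
qed

lemma gpartial_tendsto: "gpartial H i \<alpha> \<longlonglongrightarrow> tree_coeff H i \<alpha>"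
  using has_sum_imp_sums[OF class_weight_has_sum]
  unfolding gpartial_eq_sum_class_weight[abs_def] sums_def_le .

section \<open>The functional equation\<close>

abbreviation tree_map :: "('n \<Rightarrow> complex) \<Rightarrow> 'n \<Rightarrow> complex" where
  "tree_map \<equiv> map_eval (tree_coeff H)"

context
  fixes z :: "'n \<Rightarrow> complex"
  assumes small: "small z"
begin

lemma tree_coeff_has_sum:
  "((\<lambda>\<alpha>. tree_coeff H i \<alpha> * monom z \<alpha>) has_sum (\<Sum>\<^sub>\<infinity>k. class_term H z (i, k))) UNIV"
proof (rule has_sum_SigmaD)
  show "((\<lambda>k. class_term H z (i, k)) has_sum (\<Sum>\<^sub>\<infinity>k. class_term H z (i, k))) (UNIV \<times> UNIV)"
    using has_sum_infsum[OF abs_summable_summable[OF class_term_summable[OF small]]] by simp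
  show "((\<lambda>m. class_term H z (i, \<alpha>, m)) has_sum tree_coeff H i \<alpha> * monom z \<alpha>) UNIV" for \<alpha>
    using has_sum_cmult_left[OF class_weight_has_sum] by (simp add: class_term_def)
qed

lemma ps_conv_tree_coeff: "ps_conv (tree_coeff H i) z"
  unfolding ps_conv_def by (rule has_sum_imp_summable[OF tree_coeff_has_sum])

lemma tree_map_eq_infsum: "tree_map z i = (\<Sum>\<^sub>\<infinity>k. class_term H z (i, k))"
  unfolding map_eval_def ps_eval_def by (rule infsumI[OF tree_coeff_has_sum])

lemma class_term_has_sum: "((\<lambda>k. class_term H z (i, k)) has_sum tree_map z i) UNIV"
  unfolding tree_map_eq_infsum
  by (rule has_sum_infsum[OF abs_summable_summable[OF class_term_summable[OF small]]])

lemma norm_tree_map_le: "cmod (tree_map z i) \<le> \<rho>"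
  unfolding tree_map_eq_infsum
  by (rule order_trans[OF norm_infsum_bound infsum_class_term_le])
    (fact class_term_summable[OF small] small)+

lemma branch_weight_has_sum:
  "((\<lambda>k. branch_weight H i k * monom z (fst k)) has_sum ps_eval (nonlin H i) (tree_map z)) UNIV"
proof (rule has_sum_fibres[where \<phi> = "\<lambda>ss. sum_list (map snd ss)"])
  note term_sums = class_term_summable[OF small] infsum_class_term_le[OF small]
    and coeff_conv = nonlin_conv[unfolded nonlin_def]
  have total: "infsum (list_term (higher (H i)) (class_term H z)) UNIV = ps_eval (nonlin H i) (tree_map z)"
    using infsum_list_term[OF term_sums coeff_conv] by (simp add: nonlin_def tree_map_eq_infsum[abs_def])
  show "(list_term (higher (H i)) (class_term H z) has_sum ps_eval (nonlin H i) (tree_map z)) UNIV"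
    unfolding total[symmetric]
    by (rule has_sum_infsum[OF abs_summable_summable[OF list_term_summable[OF term_sums coeff_conv]]])
  show "(list_term (higher (H i)) (class_term H z) has_sum branch_weight H i k * monom z (fst k))
      {ss. sum_list (map snd ss) = k}" for k
    by (rule has_sum_branch_weight) (simp add: class_term_def)
qed

lemma leaf_weight_has_sum: "((\<lambda>k. leaf_weight i k * monom z (fst k)) has_sum z i) UNIV"
  by (rule has_sum_finite_neutralI[of "{(unitidx i, 0)}"]) (auto simp: leaf_weight_def)

lemma tree_map_fixpoint:
  "tree_map z i = (\<Sum>j\<in>UNIV. H i (unitidx j) * tree_map z j) + (z i + ps_eval (nonlin H i) (tree_map z))"
proof -
  have "((\<lambda>k. (\<Sum>j\<in>UNIV. H i (unitidx j) * class_term H z (j, k))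
        + (leaf_weight i k * monom z (fst k) + branch_weight H i k * monom z (fst k)))
      has_sum (\<Sum>j\<in>UNIV. H i (unitidx j) * tree_map z j) + (z i + ps_eval (nonlin H i) (tree_map z))) UNIV"
    by (intro has_sum_add has_sum_sum has_sum_cmult_right class_term_has_sum
          leaf_weight_has_sum branch_weight_has_sum)
  then have "((\<lambda>k. class_term H z (i, fst k, Suc (snd k)))
      has_sum (\<Sum>j\<in>UNIV. H i (unitidx j) * tree_map z j) + (z i + ps_eval (nonlin H i) (tree_map z))) UNIV"
    by (simp add: class_term_def class_weight_Suc distrib_right sum_distrib_right mult.assoc)
  then have "((\<lambda>k. class_term H z (i, k))
      has_sum (\<Sum>j\<in>UNIV. H i (unitidx j) * tree_map z j) + (z i + ps_eval (nonlin H i) (tree_map z))) UNIV"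
    by (subst (asm) has_sum_Suc_snd_iff) (simp add: class_term_def)
  then show ?thesis by (rule has_sum_unique[OF class_term_has_sum])
qed

lemma Fcoeff_tree_map: "map_eval (Fcoeff H) (tree_map z) = z"
proof
  show "map_eval (Fcoeff H) (tree_map z) i = z i" for i
    unfolding map_eval_Fcoeff[OF Fcoeff_conv norm_tree_map_le] diff_eq_eq
    using tree_map_fixpoint[of i] by (simp only: ac_simps)
qed

end

section \<open>Local inversion\<close>

lemma ps_conv_Fcoeff: "(\<And>j. cmod (v j) \<le> \<rho>) \<Longrightarrow> ps_conv (Fcoeff H i) v"
  unfolding ps_conv_def by (rule has_sum_imp_summable[OF abs_conv_imp_has_sum[OF Fcoeff_conv]])

text \<open>Two points with the same image under \<open>F\<close> differ by some \<open>x = A x + q\<close> with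
  \<open>C |q| \<le> |x| / 2\<close>, whereas \<open>|x| \<le> C |q|\<close>.\<close>

lemma Fcoeff_inj_near_0:
  assumes v_le: "\<And>j. cmod (v j) \<le> \<rho>" and w_le: "\<And>j. cmod (w j) \<le> \<rho>"
    and same_image: "map_eval (Fcoeff H) v = map_eval (Fcoeff H) w"
  shows "v = w"
proof -
  define x where "x = (\<chi> i. v i - w i)"
  define q where "q = (\<chi> i. ps_eval (nonlin H i) v - ps_eval (nonlin H i) w)"
  have difference: "v i - w i
      = (\<Sum>j\<in>UNIV. H i (unitidx j) * (v j - w j)) + (ps_eval (nonlin H i) v - ps_eval (nonlin H i) w)" for i
    using fun_cong[OF same_image, of i]
    unfolding map_eval_Fcoeff[OF Fcoeff_conv v_le] map_eval_Fcoeff[OF Fcoeff_conv w_le]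
    by (simp add: right_diff_distrib sum_subtractf algebra_simps)
  have "x = linmat H *v x + q"
    unfolding vec_eq_iff x_def q_def linmat_def matrix_vector_mult_def vec_lambda_beta vector_add_component
    using difference by blast
  then have "l1_norm x \<le> C * l1_norm q"
    by (rule affine_fixpoint_bound[OF summable_mpow])
  also have "\<dots> \<le> l1_norm x / 2"
    using nonlin_contraction[OF v_le w_le, where \<delta> = "l1_norm x"] norm_nth_le_l1_norm[of x]
    by (simp add: q_def x_def l1_norm_def)
  finally have "norm (x $ i) \<le> 0" for i using norm_nth_le_l1_norm[of x i] by linarith
  then show ?thesis by (simp add: x_def fun_eq_iff)
qed

lemma tree_map_Fcoeff:
  assumes "\<And>j. cmod (w j) \<le> \<rho>" and "small (map_eval (Fcoeff H) w)"
  shows "tree_map (map_eval (Fcoeff H) w) = w"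
  by (rule Fcoeff_inj_near_0[OF norm_tree_map_le[OF assms(2)] assms(1) Fcoeff_tree_map[OF assms(2)]])

lemma ex_polydisc_with_small_image:
  "\<exists>s>0. s \<le> \<rho> \<and> (\<forall>w. (\<forall>j. cmod (w j) \<le> s) \<longrightarrow> small (map_eval (Fcoeff H) w))"
proof -
  let ?M = "\<Sum>i\<in>UNIV. ps_majorant (Fcoeff H i) \<rho>"
  obtain s where radius: "0 < s" "s \<le> \<rho>" "C * ?M / \<rho> * s \<le> \<rho> / 2"
    using ex_pos_mult_le[OF radius_pos half_gt_zero[OF radius_pos]] by blast
  have "small (map_eval (Fcoeff H) w)" if w_le: "\<forall>j. cmod (w j) \<le> s" for w
  proof -
    have order: "Fcoeff H i \<beta> = 0" if "mdeg \<beta> < 1" for i \<beta>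
      using that mdeg_eq_0_iff[of \<beta>] by (simp add: Fcoeff_0)
    have "cmod (map_eval (Fcoeff H) w i) \<le> (s / \<rho>) ^ 1 * ps_majorant (Fcoeff H i) \<rho>" for i
    proof -
      have "cmod (map_eval (Fcoeff H) w i) \<le> ps_majorant (Fcoeff H i) s"
        unfolding map_eval_def using radius radius_pos
        by (intro norm_ps_eval_le[OF _ w_le[rule_format]] abs_conv_smaller_radius[OF Fcoeff_conv order]) auto
      also have "\<dots> \<le> (s / \<rho>) ^ 1 * ps_majorant (Fcoeff H i) \<rho>"
        using radius radius_pos by (intro ps_majorant_smaller_radius[OF Fcoeff_conv order]) auto
      finally show ?thesis .
    qed
    then have "C * (\<Sum>i\<in>UNIV. cmod (map_eval (Fcoeff H) w i)) \<le> C * (s / \<rho> * ?M)"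
      unfolding sum_distrib_left using C_nonneg by (intro mult_left_mono sum_mono) auto
    also have "\<dots> = C * ?M / \<rho> * s" by simp
    also have "\<dots> \<le> \<rho> / 2" by (rule radius(3))
    finally show ?thesis by (simp only: small_def)
  qed
  then show ?thesis using radius(1,2) by blast
qed

lemma local_right_inverse_Fcoeff_tree_coeff: "local_right_inverse (Fcoeff H) (tree_coeff H)"
proof -
  obtain r where "0 < r" and small: "(\<forall>j. cmod (z j) < r) \<Longrightarrow> small z" for z
    using ex_small_polydisc less_imp_le by metis
  then show ?thesis
    unfolding local_right_inverse_def map_conv_on_def
    using ps_conv_tree_coeff ps_conv_Fcoeff[OF norm_tree_map_le] Fcoeff_tree_map by (intro exI[of _ r]) simp
qed

lemma local_right_inverse_tree_coeff_Fcoeff: "local_right_inverse (tree_coeff H) (Fcoeff H)"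
proof -
  obtain s where radius: "0 < s" "s \<le> \<rho>"
    and small: "(\<forall>j. cmod (w j) \<le> s) \<Longrightarrow> small (map_eval (Fcoeff H) w)" for w
    using ex_polydisc_with_small_image by blast
  have "cmod (w j) \<le> \<rho>" if "\<forall>j. cmod (w j) < s" for w :: "'n \<Rightarrow> complex" and j
    using that radius(2) by (meson less_imp_le order_trans)
  moreover have "small (map_eval (Fcoeff H) w)" if "\<forall>j. cmod (w j) < s" for w
    using that by (simp add: small less_imp_le)
  ultimately show ?thesis
    unfolding local_right_inverse_def map_conv_on_def
    using radius(1) ps_conv_Fcoeff ps_conv_tree_coeff tree_map_Fcoeff by (intro exI[of _ s]) simp
qed

end

lemma
  fixes N :: "'i::finite \<Rightarrow> ('n::finite \<Rightarrow> nat) \<Rightarrow> complex" and C x \<rho> :: real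
  assumes conv: "\<And>i. abs_conv (N i) x" and order: "\<And>i \<beta>. mdeg \<beta> < 2 \<Longrightarrow> N i \<beta> = 0"
    and "0 \<le> C" and radii: "0 < \<rho>" "2 * \<rho> \<le> x"
    and small: "C * (4 / x\<^sup>2 * (\<Sum>i\<in>UNIV. ps_majorant (N i) x)) * \<rho> \<le> 1 / 2"
  shows sum_ps_majorant_le_half: "C * (\<Sum>i\<in>UNIV. ps_majorant (N i) \<rho>) \<le> \<rho> / 2"
    and sum_ps_eval_diff_le_half: "\<lbrakk>\<And>j. cmod (v j) \<le> \<rho>; \<And>j. cmod (w j) \<le> \<rho>; \<And>j. cmod (v j - w j) \<le> \<delta>\<rbrakk> \<Longrightarrow>
      C * (\<Sum>i\<in>UNIV. cmod (ps_eval (N i) v - ps_eval (N i) w)) \<le> \<delta> / 2"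
proof -
  let ?M = "\<Sum>i\<in>UNIV. ps_majorant (N i) x"
  have "(\<Sum>i\<in>UNIV. ps_majorant (N i) \<rho>) \<le> (\<rho> / x)\<^sup>2 * ?M"
    unfolding sum_distrib_left
    using radii by (intro sum_mono ps_majorant_smaller_radius[OF conv order]) auto
  then have "C * (\<Sum>i\<in>UNIV. ps_majorant (N i) \<rho>) \<le> C * ((\<rho> / x)\<^sup>2 * ?M)"
    using \<open>0 \<le> C\<close> by (rule mult_left_mono)
  also have "\<dots> = (C * (4 / x\<^sup>2 * ?M) * \<rho>) * \<rho> / 4"
    by (simp add: power2_eq_square)
  also have "\<dots> \<le> 1 / 2 * \<rho> / 4"
    using small radii by (intro divide_right_mono mult_right_mono) auto
  finally show "C * (\<Sum>i\<in>UNIV. ps_majorant (N i) \<rho>) \<le> \<rho> / 2"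
    using radii(1) by simp
next
  let ?M = "\<Sum>i\<in>UNIV. ps_majorant (N i) x"
  assume v_le: "\<And>j. cmod (v j) \<le> \<rho>" and w_le: "\<And>j. cmod (w j) \<le> \<rho>" and diff_le: "\<And>j. cmod (v j - w j) \<le> \<delta>"
  have "0 \<le> \<delta>" using diff_le norm_ge_zero order_trans by blast
  have "(\<Sum>i\<in>UNIV. cmod (ps_eval (N i) v - ps_eval (N i) w)) \<le> 4 * \<rho> / x\<^sup>2 * ?M * \<delta>"
    unfolding sum_distrib_left sum_distrib_right
    by (intro sum_mono norm_ps_eval_diff_le conv order v_le w_le diff_le radii)
  then have "C * (\<Sum>i\<in>UNIV. cmod (ps_eval (N i) v - ps_eval (N i) w)) \<le> C * (4 * \<rho> / x\<^sup>2 * ?M * \<delta>)"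
    using \<open>0 \<le> C\<close> by (rule mult_left_mono)
  also have "\<dots> = (C * (4 / x\<^sup>2 * ?M) * \<rho>) * \<delta>" by simp
  also have "\<dots> \<le> 1 / 2 * \<delta>" using small \<open>0 \<le> \<delta>\<close> by (rule mult_right_mono)
  finally show "C * (\<Sum>i\<in>UNIV. cmod (ps_eval (N i) v - ps_eval (N i) w)) \<le> \<delta> / 2" by simp
qed

lemma ex_inversion_radius:
  assumes "map_conv_on (Fcoeff H) R" and "0 < R" and summable: "summable (mpow (linmat H))"
  shows "\<exists>\<rho>. inversion_radius H \<rho>"
proof -
  define x where "x = R / 2"
  have x_pos: "0 < x" using assms(2) by (simp add: x_def)
  have F_conv: "abs_conv (Fcoeff H i) x" for i
    using map_conv_on_imp_abs_conv[OF assms(1)] assms(2) by (simp add: x_def)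
  have N_conv: "abs_conv (nonlin H i) x" for i
    using abs_conv_nonlin[OF F_conv] x_pos by simp
  obtain \<rho> where "0 < \<rho>" "\<rho> \<le> x / 2"
    and small: "mpow_norm_sum (linmat H) * (4 / x\<^sup>2 * (\<Sum>i\<in>UNIV. ps_majorant (nonlin H i) x)) * \<rho> \<le> 1 / 2"
    using ex_pos_mult_le[OF half_gt_zero[OF x_pos] half_gt_zero[OF zero_less_one]] by blast
  then have radii: "0 < \<rho>" "2 * \<rho> \<le> x" by auto
  have "inversion_radius H \<rho>"
  proof
    show "abs_conv (Fcoeff H i) \<rho>" for i
      using radii x_pos by (intro abs_conv_smaller_radius[OF F_conv, of 0]) auto
    note bounds = N_conv nonlin_eq_0 mpow_norm_sum_nonneg[OF summable] radii small
    show "mpow_norm_sum (linmat H) * (\<Sum>i\<in>UNIV. ps_majorant (nonlin H i) \<rho>) \<le> \<rho> / 2"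
      by (rule sum_ps_majorant_le_half[where N = "nonlin H", OF bounds])
    show "mpow_norm_sum (linmat H) * (\<Sum>i\<in>UNIV. cmod (ps_eval (nonlin H i) v - ps_eval (nonlin H i) w))
        \<le> \<delta> / 2"
      if "\<And>j. cmod (v j) \<le> \<rho>" "\<And>j. cmod (w j) \<le> \<rho>" "\<And>j. cmod (v j - w j) \<le> \<delta>" for v w \<delta>
      by (rule sum_ps_eval_diff_le_half[where N = "nonlin H", OF bounds that])
  qed (fact summable radii(1))+
  then show ?thesis ..
qed

theorem theorem2p3:
  fixes H :: "'n::finite \<Rightarrow> ('n \<Rightarrow> nat) \<Rightarrow> complex"
  assumes Fconv: "\<exists>r>0. map_conv_on (Fcoeff H) r"
    and Aconv: "summable (\<lambda>k. mpow (linmat H) k)"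
  shows "\<exists>g :: 'n \<Rightarrow> ('n \<Rightarrow> nat) \<Rightarrow> complex.
           (\<forall>i \<alpha>. \<alpha> \<noteq> (\<lambda>_. 0) \<longrightarrow> gpartial H i \<alpha> \<longlonglongrightarrow> g i \<alpha>) \<and>
           (let G = (\<lambda>i \<alpha>. if \<alpha> = (\<lambda>_. 0) then 0 else g i \<alpha>) in
              (\<exists>r>0. map_conv_on G r \<and>
                 (\<forall>z. (\<forall>j. cmod (z j) < r) \<longrightarrow>
                    (\<forall>i. ps_conv (Fcoeff H i) (map_eval G z)) \<and>
                    map_eval (Fcoeff H) (map_eval G z) = z)) \<and>
              (\<exists>s>0. map_conv_on (Fcoeff H) s \<and>
                 (\<forall>w. (\<forall>j. cmod (w j) < s) \<longrightarrow>
                    (\<forall>i. ps_conv (G i) (map_eval (Fcoeff H) w)) \<and>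
                    map_eval G (map_eval (Fcoeff H) w) = w)))"
proof -
  obtain \<rho> where "inversion_radius H \<rho>"
    using Fconv Aconv ex_inversion_radius by blast
  then interpret inversion_radius H \<rho> .
  have constant_term: "(if \<alpha> = (\<lambda>_. 0) then 0 else tree_coeff H i \<alpha>) = tree_coeff H i \<alpha>" for i \<alpha>
    by (simp add: tree_coeff_0 flip: func_zero)
  show ?thesis
    using gpartial_tendsto local_right_inverse_Fcoeff_tree_coeff local_right_inverse_tree_coeff_Fcoeff
    unfolding local_right_inverse_def Let_def by (intro exI[of _ "tree_coeff H"]) (simp add: constant_term)
qed

end
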